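(* Let $d\ge 1$, let $\gamma>0$, and let $\beta_1,\dots,\beta_{d+1}>0$ satisfy $\sum_{j=1}^{d+1}\beta_j-\beta_k<1$ for every $k=1,2,\dots,d+1$. Assume that (a) $\xi\sim\mathrm{Beta}(1,\gamma)$; (b) $p=(p_1,\dots,p_d):\mathcal{S}_d\to\mathcal{S}_d$ is defined by $$p_k(z_1,\dots,z_d)=\beta_k(1-z_k)+\Big(1-\sum_{j=1}^{d+1}\beta_j+\beta_k\Big)z_k,\qquad k=1,2,\dots,d,$$ and $p_0:=1-\sum_{k=1}^d p_k$; (c) $Z\sim\mathrm{Dirichlet}(\beta_1\gamma,\beta_2\gamma,\dots,\beta_d\gamma,\beta_{d+1}\gamma)$. Let $\Theta$ be a random vector with values in $\{E_0,\dots,E_d\}$ such that $\mathbb{P}(\Theta=E_j\mid Z=z)=p_j(z)$ for $j=0,1,\dots,d$, and let $\xi$ be independent of $(Z,\Theta)$. Then $$Z\overset{d}{=}(1-\xi)Z+\xi\Theta .$$ Consequently, the Markov chain $\{Z_n\}_{n\ge 0}$ in $\mathcal{S}_d$ associated with $\xi$ and $p$ (see context) converges in distribution, as $n\to\infty$, to $\mathrm{Dirichlet}(\beta_1\gamma,\dots,\beta_d\gamma,\beta_{d+1}\gamma)$.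
   Context: The standard orthogonal simplex is $\mathcal{S}_d=\{(z_1,\dots,z_d)\in\mathbb{R}^d:\ z_1+\dots+z_d\le 1,\ z_j\ge 0,\ j=1,\dots,d\}$, with interior $\mathcal{S}_d^o$. Its vertices are $E_0=(0,\dots,0)$ and the standard basis vectors $E_1,\dots,E_d$ of $\mathbb{R}^d$. $\mathrm{Beta}(a,b)$ has density $\frac{\Gamma(a+b)}{\Gamma(a)\Gamma(b)}x^{a-1}(1-x)^{b-1}$ on $(0,1)$. $\mathrm{Dirichlet}(\alpha_1,\dots,\alpha_{d+1})$ is the distribution on $\mathcal{S}_d$ with density $$\frac{\Gamma\left(\sum_{i=1}^{d+1}\alpha_i\right)}{\prod_{i=1}^{d+1}\Gamma(\alpha_i)}\Big(1-\sum_{i=1}^d z_i\Big)^{\alpha_{d+1}-1}\prod_{i=1}^d z_i^{\alpha_i-1},\qquad (z_1,\dots,z_d)\in\mathcal{S}_d^o.$$ The Markov chain associated with $\xi$ and $p$: $Z_0\in\mathcal{S}_d$ is an initial point, and for $n=0,1,2,\dots$, $Z_{n+1}=(1-\xi_n)Z_n+\xi_n\Theta_n$, where $\xi_0,\xi_1,\dots$ are independent copies of $\xi$, with $\xi_n$ independent of $(Z_0,\dots,Z_n)$ and of $(\xi_k,\Theta_k)_{k<n}$, and $\Theta_n$ is a discrete random vector with values in $\{E_0,\dots,E_d\}$ such that $\mathbb{P}(\Theta_n=E_j\mid Z_0,\dots,Z_n;\xi_n)=p_j(Z_n)$ for $j=0,1,\dots,d$. *)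

theory Defs
  imports "HOL-Probability.Probability"
begin

text \<open>
  The dimension is \<open>d = CARD('d)\<close>. Families with \<open>d + 1\<close> members are indexed by
  \<open>'d option\<close>: \<open>Some k\<close> stands for an index in \<open>1, \<dots>, d\<close>, and \<open>None\<close> for the additional
  one, which is written \<open>d + 1\<close> for parameters and \<open>0\<close> for vertices and their probabilities.
\<close>

definition orth_simplex :: "(real ^ 'd::finite) set" where
  "orth_simplex = {z. (\<Sum>j\<in>UNIV. z $ j) \<le> 1 \<and> (\<forall>j. 0 \<le> z $ j)}"

definition vertex :: "'d::finite option \<Rightarrow> real ^ 'd" where
  "vertex j = (case j of None \<Rightarrow> 0 | Some k \<Rightarrow> axis k 1)"

definition beta_distribution :: "real \<Rightarrow> real \<Rightarrow> real measure" where
  "beta_distribution a b = density lborel (\<lambda>x. ennreal (indicator {0<..<1} x *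
     (Gamma (a + b) / (Gamma a * Gamma b) * x powr (a - 1) * (1 - x) powr (b - 1))))"

definition dirichlet_distribution :: "('d::finite option \<Rightarrow> real) \<Rightarrow> (real ^ 'd) measure" where
  "dirichlet_distribution \<alpha> = density lborel (\<lambda>z. ennreal (indicator (interior orth_simplex) z *
     (Gamma (\<Sum>i\<in>UNIV. \<alpha> i) / (\<Prod>i\<in>UNIV. Gamma (\<alpha> i))
       * (1 - (\<Sum>i\<in>UNIV. z $ i)) powr (\<alpha> None - 1)
       * (\<Prod>i\<in>UNIV. (z $ i) powr (\<alpha> (Some i) - 1)))))"

definition vertex_prob ::
    "(real ^ 'd::finite \<Rightarrow> real ^ 'd) \<Rightarrow> 'd option \<Rightarrow> real ^ 'd \<Rightarrow> real" where
  "vertex_prob p j z = (case j of None \<Rightarrow> 1 - (\<Sum>k\<in>UNIV. p z $ k) | Some k \<Rightarrow> p z $ k)"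

definition linear_p :: "('d::finite option \<Rightarrow> real) \<Rightarrow> real ^ 'd \<Rightarrow> real ^ 'd" where
  "linear_p \<beta> z = (\<chi> k. \<beta> (Some k) * (1 - z $ k)
     + (1 - (\<Sum>j\<in>UNIV. \<beta> j) + \<beta> (Some k)) * z $ k)"

text \<open>
  Independence of two random variables with possibly different value types; the library's
  \<open>indep_var\<close> requires the same type for both.
\<close>

definition independent_rvs ::
    "'a measure \<Rightarrow> 'b measure \<Rightarrow> ('a \<Rightarrow> 'b) \<Rightarrow> 'c measure \<Rightarrow> ('a \<Rightarrow> 'c) \<Rightarrow> bool" where
  "independent_rvs M N X K Y \<longleftrightarrow>
     X \<in> measurable M N \<and> Y \<in> measurable M K \<and>
     prob_space.indep_set M (sets (vimage_algebra (space M) X N)) (sets (vimage_algebra (space M) Y K))"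

text \<open>
  \<open>vertex_kernel M X N Z \<Theta> p\<close>: \<open>\<Theta>\<close> takes values in the vertex set and, conditionally on the
  \<open>\<sigma>\<close>-algebra generated by \<open>X\<close> (valued in \<open>N\<close>), equals the \<open>j\<close>-th vertex with probability
  \<open>p\<^sub>j(Z)\<close>.
\<close>

definition vertex_kernel ::
    "'a measure \<Rightarrow> ('a \<Rightarrow> 'b) \<Rightarrow> 'b measure \<Rightarrow> ('a \<Rightarrow> real ^ 'd::finite) \<Rightarrow> ('a \<Rightarrow> real ^ 'd)
      \<Rightarrow> (real ^ 'd \<Rightarrow> real ^ 'd) \<Rightarrow> bool" where
  "vertex_kernel M X N Z \<Theta> p \<longleftrightarrow>
     \<Theta> \<in> borel_measurable M \<and>
     (\<forall>\<omega>\<in>space M. \<Theta> \<omega> \<in> range vertex) \<and>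
     (\<forall>j. AE \<omega> in M.
        real_cond_exp M (vimage_algebra (space M) X N)
          (indicator {\<omega>\<in>space M. \<Theta> \<omega> = vertex j}) \<omega> = vertex_prob p j (Z \<omega>))"

text \<open>
  The Markov chain driven by independent \<open>\<xi> n\<close> with law \<open>\<nu>\<close>. Independence of \<open>\<xi> n\<close> from the
  history of \<open>Z\<close> and from the earlier pairs \<open>(\<xi> k, \<Theta> k)\<close> is required separately, which is
  implied by independence from both jointly.
\<close>

definition associated_chain ::
    "'a measure \<Rightarrow> real measure \<Rightarrow> (real ^ 'd::finite \<Rightarrow> real ^ 'd)
      \<Rightarrow> (nat \<Rightarrow> 'a \<Rightarrow> real ^ 'd) \<Rightarrow> (nat \<Rightarrow> 'a \<Rightarrow> real) \<Rightarrow> (nat \<Rightarrow> 'a \<Rightarrow> real ^ 'd) \<Rightarrow> bool" where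
  "associated_chain M \<nu> p Z \<xi> \<Theta> \<longleftrightarrow>
     prob_space M \<and>
     Z 0 \<in> borel_measurable M \<and> (\<forall>\<omega>\<in>space M. Z 0 \<omega> \<in> orth_simplex) \<and>
     (\<forall>n. \<forall>\<omega>\<in>space M. Z (Suc n) \<omega> = (1 - \<xi> n \<omega>) *\<^sub>R Z n \<omega> + \<xi> n \<omega> *\<^sub>R \<Theta> n \<omega>) \<and>
     prob_space.indep_vars M (\<lambda>_. borel) \<xi> UNIV \<and>
     (\<forall>n. distr M borel (\<xi> n) = \<nu>) \<and>
     (\<forall>n. independent_rvs M borel (\<xi> n)
        (PiM {..n} (\<lambda>_. borel)) (\<lambda>\<omega>. \<lambda>k\<in>{..n}. Z k \<omega>)) \<and>
     (\<forall>n. independent_rvs M borel (\<xi> n)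
        (PiM {..<n} (\<lambda>_. borel \<Otimes>\<^sub>M borel)) (\<lambda>\<omega>. \<lambda>k\<in>{..<n}. (\<xi> k \<omega>, \<Theta> k \<omega>))) \<and>
     (\<forall>n. vertex_kernel M (\<lambda>\<omega>. (\<lambda>k\<in>{..n}. Z k \<omega>, \<xi> n \<omega>))
        (PiM {..n} (\<lambda>_. borel) \<Otimes>\<^sub>M borel) (Z n) (\<Theta> n) p)"

text \<open>
  Weak convergence of laws against bounded continuous test functions; the library's
  \<open>weak_conv_m\<close> is confined to measures on the real line.
\<close>

definition converges_weakly ::
    "(nat \<Rightarrow> 'b::topological_space measure) \<Rightarrow> 'b measure \<Rightarrow> bool" where
  "converges_weakly \<mu>s \<mu> \<longleftrightarrow>
     (\<forall>f :: 'b \<Rightarrow> real. continuous_on UNIV f \<longrightarrow> bounded (range f) \<longrightarrow>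
        (\<lambda>n. integral\<^sup>L (\<mu>s n) f) \<longlonglongrightarrow> integral\<^sup>L \<mu> f)"

end

theory Submission
  imports Defs
begin

text \<open>
  Write \<open>x\<^sub>0, \<dots>, x\<^sub>d\<close> for the barycentric coordinates of a point of the simplex, \<open>\<beta>\<^sub>0\<close> for the
  extra parameter \<open>\<beta>\<^bsub>d+1\<^esub>\<close>, and \<open>B\<close> for the sum of all \<open>\<beta>\<^sub>j\<close>. The vertex probabilities then take
  the symmetric form \<open>p\<^sub>j(x) = \<beta>\<^sub>j + (1 - B) x\<^sub>j\<close> for every \<open>j\<close>, including \<open>j = 0\<close>, and the step
  \<open>x \<mapsto> (1 - \<xi>) x + \<xi> E\<^sub>j\<close> multiplies each coordinate by \<open>1 - \<xi>\<close> and adds \<open>\<xi>\<close> to the \<open>j\<close>-th. The whole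
  proof is the method of moments for the monomials \<open>x\<^sup>m = \<Prod>\<^sub>j x\<^sub>j\<^bsup>m\<^sub>j\<^esup>\<close>.

  Expanding \<open>((1 - \<xi>) x + \<xi> E\<^sub>j)\<^sup>m\<close> by the binomial theorem and averaging over \<open>j\<close> and \<open>\<xi>\<close> expresses the
  moments after a step through those before it (\<open>moments_one_step\<close>). By \<open>\<Sum>\<^sub>j p\<^sub>j = 1\<close> the terms of
  degree above \<open>|m|\<close> collapse to degree \<open>|m|\<close>, so the resulting operator \<open>moment_step\<close> on families of moments is
  triangular with respect to the degree. Its diagonal entry in degree \<open>N\<close> is
  \<open>E (1 - \<xi>)\<^sup>N + N (1 - B) E (1 - \<xi>)\<^bsup>N-1\<^esup> \<xi>\<close>.

  Two facts about this operator give the theorem. Its diagonal entries have modulus below \<open>1\<close> for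
  \<open>N > 0\<close> (\<open>moment_factor_less_1\<close>; the bound \<open>B < 2\<close> that this uses follows
  from the hypothesis on \<open>\<beta>\<close>), so the difference of
  two of its orbits with the same moment of degree \<open>0\<close> vanishes in the limit, by induction on the
  degree (\<open>moment_iteration_tendsto_0\<close>). And the Dirichlet moments, which are quotients of rising
  factorials because a monomial only shifts the Dirichlet parameters, are a fixed point
  (\<open>dirichlet_moment_fixed\<close>): for each \<open>j\<close> the sum over the binomial index telescopes.

  Since the simplex is compact and polynomials are dense in its continuous functions
  (\<open>bary_polys_dense\<close>), moments determine laws on the simplex and their convergence is weak
  convergence. Invariance of the moments is therefore invariance of the law, and convergence of the
  moments along the chain is convergence in distribution.
\<close>

section \<open>Barycentric coordinates\<close>

definition bary :: "real ^ 'd::finite \<Rightarrow> 'd option \<Rightarrow> real" where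
  "bary z j = (case j of None \<Rightarrow> 1 - (\<Sum>k\<in>UNIV. z $ k) | Some k \<Rightarrow> z $ k)"

definition bary_monomial :: "('d::finite option \<Rightarrow> nat) \<Rightarrow> real ^ 'd \<Rightarrow> real" where
  "bary_monomial m z = (\<Prod>j\<in>UNIV. bary z j ^ m j)"

lemma sum_option_UNIV: "(\<Sum>j\<in>UNIV. f j) = f None + (\<Sum>k\<in>UNIV. f (Some k))"
  for f :: "'d::finite option \<Rightarrow> 'b::comm_monoid_add"
  by (simp add: UNIV_option_conv sum.reindex)

lemma prod_option_UNIV: "(\<Prod>j\<in>UNIV. f j) = f None * (\<Prod>k\<in>UNIV. f (Some k))"
  for f :: "'d::finite option \<Rightarrow> 'b::comm_monoid_mult"
  by (simp add: UNIV_option_conv prod.reindex)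

lemma Basis_vec_real: "(Basis :: (real ^ 'd::finite) set) = range (\<lambda>i. axis i 1)"
  by (auto simp: Basis_vec_def)

lemma inj_axis_1: "inj (\<lambda>i. axis i (1::real))"
  by (auto simp: inj_on_def axis_eq_axis)

lemma sum_Basis_vec_real: "(\<Sum>b\<in>(Basis :: (real ^ 'd::finite) set). f b) = (\<Sum>i\<in>UNIV. f (axis i 1))"
  by (simp add: Basis_vec_real sum.reindex inj_axis_1)

lemma prod_Basis_vec_real: "(\<Prod>b\<in>(Basis :: (real ^ 'd::finite) set). f b) = (\<Prod>i\<in>UNIV. f (axis i 1))"
  by (simp add: Basis_vec_real prod.reindex inj_axis_1)

lemma sum_bary: "(\<Sum>j\<in>UNIV. bary z j) = 1"
  by (simp add: sum_option_UNIV bary_def)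

lemma orth_simplex_iff_bary: "z \<in> orth_simplex \<longleftrightarrow> (\<forall>j. 0 \<le> bary z j)"
  by (auto simp: orth_simplex_def bary_def split: option.splits)

lemma orth_simplex_eq_hull: "(orth_simplex :: (real ^ 'd::finite) set) = convex hull (insert 0 Basis)"
  by (auto simp: std_simplex orth_simplex_def sum_Basis_vec_real)
     (auto simp: Basis_vec_real inner_axis)

lemma interior_simplex_iff_bary: "z \<in> interior orth_simplex \<longleftrightarrow> (\<forall>j. 0 < bary z j)"
proof -
  have "z \<in> interior orth_simplex \<longleftrightarrow> (\<forall>i. 0 < z $ i) \<and> (\<Sum>i\<in>UNIV. z $ i) < 1"
    unfolding orth_simplex_eq_hull interior_std_simplex sum_Basis_vec_real
    by (simp add: Basis_vec_real inner_axis)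
  also have "\<dots> \<longleftrightarrow> (\<forall>j. 0 < bary z j)"
    by (auto simp: bary_def split_option_all)
  finally show ?thesis .
qed

lemma compact_orth_simplex: "compact (orth_simplex :: (real ^ 'd::finite) set)"
  by (simp add: orth_simplex_eq_hull finite_imp_compact_convex_hull)

lemma orth_simplex_borel [measurable]: "orth_simplex \<in> sets borel"
  by (intro borel_closed compact_imp_closed compact_orth_simplex)

lemma continuous_on_bary [continuous_intros]: "continuous_on S (\<lambda>z. bary z j)"
  by (cases j) (auto simp: bary_def intro!: continuous_intros)

lemma borel_measurable_bary [measurable]: "(\<lambda>z. bary z j) \<in> borel_measurable borel"
  by (intro borel_measurable_continuous_onI continuous_intros)

lemma continuous_on_bary_monomial: "continuous_on S (bary_monomial m)"
  unfolding bary_monomial_def by (intro continuous_intros)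

lemma borel_measurable_bary_monomial [measurable]: "bary_monomial m \<in> borel_measurable borel"
  by (intro borel_measurable_continuous_onI continuous_on_bary_monomial)

lemma bary_le_1: "z \<in> orth_simplex \<Longrightarrow> bary z j \<le> 1"
  using member_le_sum[of j UNIV "bary z"] by (simp add: orth_simplex_iff_bary sum_bary)

section \<open>Moments of the Dirichlet distribution\<close>

lemma Gamma_real_nonzero: "x > 0 \<Longrightarrow> Gamma x \<noteq> 0" for x :: real
  using Gamma_real_pos[of x] by (metis less_irrefl)

lemma nn_integral_Beta_scaled:
  fixes a b s :: real
  assumes "a > 0" "b > 0" "s > 0"
  shows "(\<integral>\<^sup>+t. ennreal (indicator {0<..<s} t * (t powr (a - 1) * (s - t) powr (b - 1))) \<partial>lborel)
         = ennreal (Beta a b * s powr (a + b - 1))"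
proof -
  let ?f = "\<lambda>t::real. ennreal (indicator {0<..<s} t * (t powr (a - 1) * (s - t) powr (b - 1)))"
  have "((\<lambda>t. t powr (a - 1) * (1 - t) powr (b - 1)) has_integral Beta a b) {0<..<1}"
    using has_integral_Beta_real[of a b] assms by (simp add: has_integral_Icc_iff_Ioo)
  from nn_integral_has_integral_lebesgue[OF _ this]
  have unit: "(\<integral>\<^sup>+t. ennreal (indicator {0<..<1} t * (t powr (a - 1) * (1 - t) powr (b - 1))) \<partial>lborel)
      = ennreal (Beta a b)"
    by (simp add: mult_ac indicator_def if_distrib cong: if_cong)
  have "(\<integral>\<^sup>+t. ?f t \<partial>lborel) = ennreal \<bar>s\<bar> * (\<integral>\<^sup>+t. ?f (0 + s * t) \<partial>lborel)"
    using assms by (intro nn_integral_real_affine) auto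
  also have "(\<integral>\<^sup>+t. ?f (0 + s * t) \<partial>lborel) =
     (\<integral>\<^sup>+t. ennreal (s powr (a + b - 2)) *
        ennreal (indicator {0<..<1} t * (t powr (a - 1) * (1 - t) powr (b - 1))) \<partial>lborel)"
  proof (intro nn_integral_cong)
    fix t :: real
    have "s * t < s \<longleftrightarrow> t < 1" "0 < s * t \<longleftrightarrow> 0 < t" using assms
      by (auto simp: zero_less_mult_iff)
    moreover have "(s * t) powr (a - 1) * (s - s * t) powr (b - 1) =
       s powr (a + b - 2) * (t powr (a - 1) * (1 - t) powr (b - 1))" if "0 < t" "t < 1"
    proof -
      have "s - s * t = s * (1 - t)" by (simp add: algebra_simps)
      moreover have "s powr (a + b - 2) = s powr (a - 1) * s powr (b - 1)"
        by (simp add: powr_add[symmetric])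
      ultimately show ?thesis using that assms by (simp add: powr_mult)
    qed
    ultimately show "?f (0 + s * t) = ennreal (s powr (a + b - 2)) *
        ennreal (indicator {0<..<1} t * (t powr (a - 1) * (1 - t) powr (b - 1)))"
      by (auto simp: indicator_def ennreal_mult[symmetric])
  qed
  also have "\<dots> = ennreal (s powr (a + b - 2)) * ennreal (Beta a b)"
    by (subst nn_integral_cmult) (auto simp: unit)
  also have "ennreal \<bar>s\<bar> * \<dots> = ennreal (Beta a b * s powr (a + b - 1))"
  proof -
    have "s * s powr (a + b - 2) = s powr (a + b - 1)"
      using assms powr_add[of s 1 "a + b - 2"] by simp
    moreover have "Beta a b \<ge> 0"
      using assms by (simp add: Beta_def Gamma_real_nonneg)
    ultimately show ?thesis using assms
      by (simp add: ennreal_mult[symmetric] mult_ac)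
  qed
  finally show ?thesis .
qed

text \<open>
  The simplex of size \<open>s\<close> is allowed so that an induction on the number of variables closes: once one
  coordinate \<open>y\<close> is fixed, the others range over the simplex of size \<open>s - y\<close>, and by homogeneity the
  remaining integral over \<open>y\<close> is a scaled Beta integral.
\<close>

lemma nn_integral_Dirichlet_PiM:
  fixes a :: "'i \<Rightarrow> real" and c s :: real
  assumes "finite I" "\<And>i. i \<in> I \<Longrightarrow> a i > 0" "c > 0" "s > 0"
  shows "(\<integral>\<^sup>+x. ennreal (indicator {x. (\<forall>i\<in>I. 0 < x i) \<and> sum x I < s} x *
             ((s - sum x I) powr (c - 1) * (\<Prod>i\<in>I. x i powr (a i - 1)))) \<partial>PiM I (\<lambda>_. lborel))
         = ennreal ((\<Prod>i\<in>I. Gamma (a i)) * Gamma c / Gamma (sum a I + c) * s powr (sum a I + c - 1))"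
  using assms
proof (induction arbitrary: s rule: finite_induct)
  case empty
  then show ?case
    using Gamma_real_nonzero[of c] by (simp add: PiM_empty nn_integral_count_space_finite)
next
  case (insert b I s)
  define W where "W I s x = indicator {x. (\<forall>i\<in>I. 0 < x i) \<and> sum x I < s} x *
             ((s - sum x I) powr (c - 1) * (\<Prod>i\<in>I. x i powr (a i - 1)))" for I s and x :: "'i \<Rightarrow> real"
  define K where "K = (\<Prod>i\<in>I. Gamma (a i)) * Gamma c / Gamma (sum a I + c)"
  interpret product_sigma_finite "\<lambda>_::'i. lborel :: real measure" by standard
  have [measurable]: "(\<lambda>x. W J s x) \<in> borel_measurable (PiM J (\<lambda>_. lborel))" if "finite J" for J s
  proof -
    have "indicator {x. (\<forall>i\<in>J. 0 < x i) \<and> sum x J < s} x =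
      (if (\<forall>i\<in>J. 0 < x i) \<and> sum x J < s then 1 else (0::real))" for x by (auto simp: indicator_def)
    then show ?thesis unfolding W_def using that by (simp only:) measurable
  qed
  have pos: "sum a I + c > 0" using insert by (intro add_nonneg_pos sum_nonneg) (auto intro: less_imp_le)
  have K0: "K \<ge> 0" unfolding K_def using insert pos
    by (intro divide_nonneg_nonneg mult_nonneg_nonneg prod_nonneg) (auto intro!: Gamma_real_nonneg less_imp_le)
  \<comment> \<open>Positivity of the other coordinates forces \<open>y < s\<close>, hence the interval indicator.\<close>
  have split: "W (insert b I) s (x(b := y)) = indicator {0<..<s} y * y powr (a b - 1) * W I (s - y) x"
    for x y
  proof -
    have restrict: "sum (x(b := y)) I = sum x I" "(\<forall>i\<in>I. 0 < (x(b := y)) i) \<longleftrightarrow> (\<forall>i\<in>I. 0 < x i)"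
      "(\<Prod>i\<in>I. (x(b := y)) i powr (a i - 1)) = (\<Prod>i\<in>I. x i powr (a i - 1))"
      using insert.hyps by (auto intro!: sum.cong prod.cong)
    have "y < s" if "\<forall>i\<in>I. 0 < x i" "y + sum x I < s"
      using sum_nonneg[of I x] that by fastforce
    moreover have "sum (x(b := y)) (insert b I) = y + sum x I"
      using insert.hyps by (simp only: sum.insert restrict fun_upd_same simp_thms)
    moreover have "(\<forall>i\<in>insert b I. 0 < (x(b := y)) i) \<longleftrightarrow> 0 < y \<and> (\<forall>i\<in>I. 0 < x i)"
      using insert.hyps by auto
    ultimately have "x(b := y) \<in> {x. (\<forall>i\<in>insert b I. 0 < x i) \<and> sum x (insert b I) < s} \<longleftrightarrow>
        y \<in> {0<..<s} \<and> x \<in> {x. (\<forall>i\<in>I. 0 < x i) \<and> sum x I < s - y}"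
      by (simp only: mem_Collect_eq greaterThanLessThan_iff less_diff_eq add.commute) blast
    moreover have "s - sum (x(b := y)) (insert b I) = s - y - sum x I"
      "(\<Prod>i\<in>insert b I. (x(b := y)) i powr (a i - 1)) = y powr (a b - 1) * (\<Prod>i\<in>I. x i powr (a i - 1))"
      using insert.hyps by (simp_all only: sum.insert prod.insert restrict fun_upd_same diff_diff_eq simp_thms)
    ultimately show ?thesis
      unfolding W_def by (auto simp only: indicator_def of_bool_def if_True if_False mult_ac mult_1_left mult_zero_left split: if_split)
  qed
  have IH: "(\<integral>\<^sup>+x. ennreal (W I (s - y) x) \<partial>PiM I (\<lambda>_. lborel)) =
      ennreal (K * (s - y) powr (sum a I + c - 1))" if "y < s" for y
    unfolding W_def K_def using insert.prems that by (intro insert.IH) auto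
  have "(\<integral>\<^sup>+x. ennreal (W (insert b I) s x) \<partial>PiM (insert b I) (\<lambda>_. lborel)) =
     (\<integral>\<^sup>+y. (\<integral>\<^sup>+x. ennreal (W (insert b I) s (x(b := y))) \<partial>PiM I (\<lambda>_. lborel)) \<partial>lborel)"
    using insert.hyps by (intro product_nn_integral_insert_rev) auto
  also have "\<dots> = (\<integral>\<^sup>+y. ennreal (indicator {0<..<s} y * y powr (a b - 1)) *
        (\<integral>\<^sup>+x. ennreal (W I (s - y) x) \<partial>PiM I (\<lambda>_. lborel)) \<partial>lborel)"
    using insert.hyps
    by (subst nn_integral_cmult[symmetric])
       (auto simp: split ennreal_mult'[symmetric] intro!: nn_integral_cong)
  also have "\<dots> = (\<integral>\<^sup>+y. ennreal K * ennreal (indicator {0<..<s} y * (y powr (a b - 1) *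
        (s - y) powr ((sum a I + c) - 1))) \<partial>lborel)"
    using K0
    by (intro nn_integral_cong) (auto simp: IH indicator_def ennreal_mult[symmetric] mult_ac)
  also have "\<dots> = ennreal K * ennreal (Beta (a b) (sum a I + c) * s powr (a b + (sum a I + c) - 1))"
    using insert.prems pos by (simp add: nn_integral_cmult nn_integral_Beta_scaled)
  also have "\<dots> = ennreal (K * (Beta (a b) (sum a I + c) * s powr (a b + (sum a I + c) - 1)))"
    using K0 by (simp add: ennreal_mult')
  also have "K * (Beta (a b) (sum a I + c) * s powr (a b + (sum a I + c) - 1)) =
     (\<Prod>i\<in>insert b I. Gamma (a i)) * Gamma c / Gamma (sum a (insert b I) + c) * s powr (sum a (insert b I) + c - 1)"
    using insert.hyps Gamma_real_nonzero[OF pos]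
    by (simp add: K_def Beta_def add_ac)
  finally show ?case unfolding W_def .
qed

text \<open>
  The unnormalized Dirichlet density. In barycentric coordinates the \<open>d + 1\<close> parameters enter
  symmetrically, and multiplication by a monomial shifts them.
\<close>

definition dirichlet_weight :: "('d::finite option \<Rightarrow> real) \<Rightarrow> real ^ 'd \<Rightarrow> real" where
  "dirichlet_weight \<alpha> z = indicator (interior orth_simplex) z * (\<Prod>j\<in>UNIV. bary z j powr (\<alpha> j - 1))"

lemma borel_measurable_dirichlet_weight [measurable]:
  "dirichlet_weight \<alpha> \<in> borel_measurable borel"
  unfolding dirichlet_weight_def by measurable

lemma dirichlet_weight_nonneg: "dirichlet_weight \<alpha> z \<ge> 0"
  by (auto simp: dirichlet_weight_def intro!: mult_nonneg_nonneg prod_nonneg)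

lemma nn_integral_dirichlet_weight:
  fixes \<alpha> :: "'d::finite option \<Rightarrow> real"
  assumes "\<And>j. \<alpha> j > 0"
  shows "(\<integral>\<^sup>+z. ennreal (dirichlet_weight \<alpha> z) \<partial>lborel) =
     ennreal ((\<Prod>j\<in>UNIV. Gamma (\<alpha> j)) / Gamma (\<Sum>j\<in>UNIV. \<alpha> j))"
proof -
  \<comment> \<open>Lebesgue measure is the product over the standard basis; \<open>idx\<close> reads off the coordinate of a
    basis vector.\<close>
  define idx where "idx = inv (\<lambda>i. axis i (1::real) :: real ^ 'd)"
  have idx [simp]: "idx (axis i 1) = i" for i
    unfolding idx_def by (rule inv_f_f[OF inj_axis_1])
  let ?B = "Basis :: (real ^ 'd) set"
  let ?x = "\<lambda>f. (\<Sum>b\<in>?B. f b *\<^sub>R b)"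
  have nth: "?x f $ i = f (axis i 1)" for f i
    by (simp add: sum_Basis_vec_real axis_def if_distrib sum.delta cong: if_cong)
  have "(\<integral>\<^sup>+z. ennreal (dirichlet_weight \<alpha> z) \<partial>lborel) =
      (\<integral>\<^sup>+f. ennreal (dirichlet_weight \<alpha> (?x f)) \<partial>PiM ?B (\<lambda>_. lborel))"
    by (subst lborel_eq, subst nn_integral_distr) auto
  also have "\<dots> = (\<integral>\<^sup>+x. ennreal (indicator {x. (\<forall>i\<in>?B. 0 < x i) \<and> sum x ?B < 1} x *
             ((1 - sum x ?B) powr (\<alpha> None - 1) * (\<Prod>i\<in>?B. x i powr (\<alpha> (Some (idx i)) - 1)))) \<partial>PiM ?B (\<lambda>_. lborel))"
  proof (intro nn_integral_cong arg_cong[where f = ennreal])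
    fix f :: "real ^ 'd \<Rightarrow> real"
    define x where "x = ?x f"
    have nth: "x $ i = f (axis i 1)" for i unfolding x_def by (rule nth)
    then have nth': "($) x = (\<lambda>i. f (axis i 1))" by (simp add: fun_eq_iff)
    have "x \<in> interior orth_simplex \<longleftrightarrow> f \<in> {x. (\<forall>i\<in>?B. 0 < x i) \<and> sum x ?B < 1}"
      unfolding interior_simplex_iff_bary split_option_all bary_def option.case nth sum_Basis_vec_real
      by (auto simp: Basis_vec_real nth sum_Basis_vec_real[unfolded Basis_vec_real])
    then show "dirichlet_weight \<alpha> (?x f) = indicator {x. (\<forall>i\<in>?B. 0 < x i) \<and> sum x ?B < 1} f *
             ((1 - sum f ?B) powr (\<alpha> None - 1) * (\<Prod>i\<in>?B. f i powr (\<alpha> (Some (idx i)) - 1)))"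
      unfolding x_def[symmetric] dirichlet_weight_def prod_option_UNIV bary_def
      by (simp only: option.case nth prod_Basis_vec_real idx) (simp add: nth' sum_Basis_vec_real indicator_def)
  qed
  also have "\<dots> = ennreal ((\<Prod>i\<in>?B. Gamma (\<alpha> (Some (idx i)))) * Gamma (\<alpha> None) /
      Gamma ((\<Sum>i\<in>?B. \<alpha> (Some (idx i))) + \<alpha> None))"
    using assms by (subst nn_integral_Dirichlet_PiM) auto
  also have "(\<Prod>i\<in>?B. Gamma (\<alpha> (Some (idx i)))) * Gamma (\<alpha> None) /
      Gamma ((\<Sum>i\<in>?B. \<alpha> (Some (idx i))) + \<alpha> None) = (\<Prod>j\<in>UNIV. Gamma (\<alpha> j)) / Gamma (\<Sum>j\<in>UNIV. \<alpha> j)"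
    by (simp only: prod_Basis_vec_real sum_Basis_vec_real idx prod_option_UNIV sum_option_UNIV)
       (simp add: mult_ac add_ac)
  finally show ?thesis .
qed

lemma dirichlet_distribution_eq:
  "dirichlet_distribution \<alpha> = density lborel (\<lambda>z. ennreal
     (Gamma (\<Sum>j\<in>UNIV. \<alpha> j) / (\<Prod>j\<in>UNIV. Gamma (\<alpha> j)) * dirichlet_weight \<alpha> z))"
  by (simp add: dirichlet_distribution_def dirichlet_weight_def bary_def prod_option_UNIV[of "\<lambda>j. _ j powr _ j"] mult_ac)

definition dirichlet_moment :: "('d::finite option \<Rightarrow> real) \<Rightarrow> ('d option \<Rightarrow> nat) \<Rightarrow> real" where
  "dirichlet_moment \<alpha> m =
     (\<Prod>j\<in>UNIV. pochhammer (\<alpha> j) (m j)) / pochhammer (\<Sum>j\<in>UNIV. \<alpha> j) (\<Sum>j\<in>UNIV. m j)"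

text \<open>
  Multiplying the density by \<open>x\<^sup>m\<close> gives the unnormalized density with parameters \<open>\<alpha> + m\<close>, so a moment
  is a quotient of two normalizing constants.
\<close>

lemma integral_bary_monomial_dirichlet:
  fixes \<alpha> :: "'d::finite option \<Rightarrow> real"
  assumes pos: "\<And>j. \<alpha> j > 0"
  shows "integral\<^sup>L (dirichlet_distribution \<alpha>) (bary_monomial m) = dirichlet_moment \<alpha> m"
proof -
  define A where "A = (\<Sum>j\<in>UNIV. \<alpha> j)"
  have A: "A > 0" unfolding A_def by (intro sum_pos) (auto simp: pos)
  define C where "C = Gamma A / (\<Prod>j\<in>UNIV. Gamma (\<alpha> j))"
  have C0: "C \<ge> 0" unfolding C_def using A pos
    by (intro divide_nonneg_nonneg prod_nonneg) (auto intro!: Gamma_real_nonneg less_imp_le)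
  have shift: "dirichlet_weight \<alpha> z * bary_monomial m z = dirichlet_weight (\<lambda>j. \<alpha> j + real (m j)) z" for z
  proof (cases "z \<in> interior orth_simplex")
    case True
    then have "0 < bary z j" for j by (simp add: interior_simplex_iff_bary)
    then show ?thesis
      by (simp add: dirichlet_weight_def bary_monomial_def prod.distrib[symmetric] powr_realpow[symmetric]
            powr_add[symmetric] algebra_simps)
  qed (simp add: dirichlet_weight_def)
  have "integral\<^sup>L (dirichlet_distribution \<alpha>) (bary_monomial m) =
     (\<integral>z. C * dirichlet_weight \<alpha> z * bary_monomial m z \<partial>lborel)"
    unfolding dirichlet_distribution_eq A_def[symmetric] C_def[symmetric]
    by (subst integral_density) (auto simp: C0 dirichlet_weight_nonneg)
  also have "\<dots> = C * (\<integral>z. dirichlet_weight (\<lambda>j. \<alpha> j + real (m j)) z \<partial>lborel)"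
    by (simp add: mult.assoc shift)
  also have "(\<integral>z. dirichlet_weight (\<lambda>j. \<alpha> j + real (m j)) z \<partial>lborel) =
      enn2real (\<integral>\<^sup>+z. ennreal (dirichlet_weight (\<lambda>j. \<alpha> j + real (m j)) z) \<partial>lborel)"
    by (intro integral_eq_nn_integral) (auto simp: dirichlet_weight_nonneg)
  also have "\<dots> = (\<Prod>j\<in>UNIV. Gamma (\<alpha> j + real (m j))) / Gamma (A + real (\<Sum>j\<in>UNIV. m j))"
  proof -
    have "(\<Prod>j\<in>UNIV. Gamma (\<alpha> j + real (m j))) / Gamma (A + real (\<Sum>j\<in>UNIV. m j)) \<ge> 0"
      using pos A
      by (intro divide_nonneg_nonneg prod_nonneg Gamma_real_nonneg ballI add_pos_nonneg) (auto intro: sum_nonneg)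
    then show ?thesis
      using pos by (simp add: nn_integral_dirichlet_weight add_pos_nonneg A_def sum.distrib)
  qed
  also have "C * \<dots> = (\<Prod>j\<in>UNIV. Gamma (\<alpha> j + real (m j)) / Gamma (\<alpha> j)) /
     (Gamma (A + real (\<Sum>j\<in>UNIV. m j)) / Gamma A)"
    by (simp add: C_def prod_dividef)
  also have "\<dots> = (\<Prod>j\<in>UNIV. pochhammer (\<alpha> j) (m j)) / pochhammer A (\<Sum>j\<in>UNIV. m j)"
  proof -
    have "pochhammer x n = Gamma (x + real n) / Gamma x" if "x > 0" for x :: real and n
      using that by (intro pochhammer_Gamma) (auto elim!: nonpos_Ints_cases)
    then show ?thesis using A pos by simp
  qed
  finally show ?thesis unfolding A_def dirichlet_moment_def .
qed

lemma prob_space_dirichlet: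
  assumes pos: "\<And>j. \<alpha> j > 0"
  shows "prob_space (dirichlet_distribution \<alpha>)"
proof
  define C where "C = Gamma (\<Sum>j\<in>UNIV. \<alpha> j) / (\<Prod>j\<in>UNIV. Gamma (\<alpha> j))"
  have "Gamma (\<Sum>j\<in>UNIV. \<alpha> j) > 0" "(\<Prod>j\<in>UNIV. Gamma (\<alpha> j)) > 0"
    by (auto intro!: Gamma_real_pos sum_pos prod_pos simp: pos)
  then have C: "C > 0" "(\<Prod>j\<in>UNIV. Gamma (\<alpha> j)) / Gamma (\<Sum>j\<in>UNIV. \<alpha> j) = inverse C"
    by (auto simp: C_def)
  then show "emeasure (dirichlet_distribution \<alpha>) (space (dirichlet_distribution \<alpha>)) = 1"
    unfolding dirichlet_distribution_eq C_def[symmetric]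
    by (simp add: emeasure_density ennreal_mult' nn_integral_cmult nn_integral_dirichlet_weight pos)
       (simp add: ennreal_mult'[symmetric])
qed

lemma sets_dirichlet [simp, measurable_cong]: "sets (dirichlet_distribution \<alpha>) = sets borel"
  by (simp add: dirichlet_distribution_def)

lemma AE_dirichlet_simplex: "AE z in dirichlet_distribution \<alpha>. z \<in> orth_simplex"
  unfolding dirichlet_distribution_eq
  using interior_subset[of orth_simplex]
  by (subst AE_density) (measurable, auto simp: dirichlet_weight_def indicator_def)

section \<open>Moments of the Beta distribution\<close>

text \<open>
  This is \<open>E (1 - \<xi>)\<^bsup>N-i\<^esup> \<xi>\<^sup>i\<close> for \<open>\<xi>\<close> with law \<open>Beta(1, \<gamma>)\<close>; see \<open>integral_beta_distribution_1\<close>.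
\<close>

definition beta_moment :: "real \<Rightarrow> nat \<Rightarrow> nat \<Rightarrow> real" where
  "beta_moment \<gamma> N i = \<gamma> * fact i * Gamma (\<gamma> + real N - real i) / Gamma (\<gamma> + real N + 1)"

lemma integral_beta_distribution_1:
  assumes "\<gamma> > 0" "i \<le> N"
  shows "(\<integral>x. (1 - x) ^ (N - i) * x ^ i \<partial>beta_distribution 1 \<gamma>) = beta_moment \<gamma> N i"
proof -
  have [simp]: "Gamma (1 + \<gamma>) / Gamma \<gamma> = \<gamma>"
    using assms Gamma_plus1[of \<gamma>] Gamma_real_nonzero[of \<gamma>] by (auto simp: add.commute nonpos_Ints_def)
  have beta: "beta_distribution 1 \<gamma> =
    density lborel (\<lambda>x. ennreal (\<gamma> * (indicator {0<..<1} x * (1 - x) powr (\<gamma> - 1))))"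
    unfolding beta_distribution_def using assms
    by (intro arg_cong[where f = "density lborel"] ext) (auto simp: indicator_def)
  have pointwise: "\<gamma> * (indicator {0<..<1} x * (1 - x) powr (\<gamma> - 1)) * ((1 - x) ^ (N - i) * x ^ i) =
      \<gamma> * (indicator {0<..<1} x * (x powr (real i + 1 - 1) * (1 - x) powr (\<gamma> + real (N - i) - 1)))" for x
    by (auto simp: indicator_def powr_realpow[symmetric] powr_add[symmetric] algebra_simps)
  have "(\<integral>x. (1 - x) ^ (N - i) * x ^ i \<partial>beta_distribution 1 \<gamma>) =
     (\<integral>x. \<gamma> * (indicator {0<..<1} x * (1 - x) powr (\<gamma> - 1)) * ((1 - x) ^ (N - i) * x ^ i) \<partial>lborel)"
    unfolding beta using assms by (subst integral_density) auto
  also have "\<dots> = \<gamma> * (\<integral>x. indicator {0<..<1} x * (x powr (real i + 1 - 1) * (1 - x) powr (\<gamma> + real (N - i) - 1)) \<partial>lborel)"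
    unfolding pointwise by simp
  also have "(\<integral>x. indicator {0<..<1} x * (x powr (real i + 1 - 1) * (1 - x) powr (\<gamma> + real (N - i) - 1)) \<partial>lborel)
     = enn2real (\<integral>\<^sup>+x. ennreal (indicator {0<..<1} x * (x powr (real i + 1 - 1) * (1 - x) powr (\<gamma> + real (N - i) - 1))) \<partial>lborel)"
    by (intro integral_eq_nn_integral) auto
  also have "\<dots> = Beta (real i + 1) (\<gamma> + real (N - i))"
    using assms by (subst nn_integral_Beta_scaled) (auto simp: Beta_def intro!: divide_nonneg_nonneg mult_nonneg_nonneg Gamma_real_nonneg)
  also have "\<gamma> * \<dots> = beta_moment \<gamma> N i"
    using assms by (simp add: Beta_def beta_moment_def Gamma_fact[symmetric] of_nat_diff algebra_simps)
  finally show ?thesis .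
qed

lemma sets_beta_distribution [simp, measurable_cong]: "sets (beta_distribution a b) = sets borel"
  by (simp add: beta_distribution_def)

lemma AE_beta_distribution: "AE x in beta_distribution a b. 0 < x \<and> x < 1"
  unfolding beta_distribution_def
  by (subst AE_density) (measurable, auto simp: indicator_def)

lemma beta_moment_0: "\<gamma> > 0 \<Longrightarrow> beta_moment \<gamma> N 0 = \<gamma> / (\<gamma> + real N)"
  using Gamma_plus1[of "\<gamma> + real N"] Gamma_real_nonzero[of "\<gamma> + real N"]
  by (auto simp: beta_moment_def nonpos_Ints_def)

lemma beta_moment_Suc:
  assumes "\<gamma> > 0" "i < N"
  shows "beta_moment \<gamma> N (Suc i) * (\<gamma> + real N - real (Suc i)) = real (Suc i) * beta_moment \<gamma> N i"
proof -
  have "\<gamma> + real N - real (Suc i) > 0" using assms by linarith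
  then have "Gamma (\<gamma> + real N - real (Suc i) + 1) = (\<gamma> + real N - real (Suc i)) * Gamma (\<gamma> + real N - real (Suc i))"
    by (intro Gamma_plus1) (auto elim!: nonpos_Ints_cases)
  moreover have "\<gamma> + real N - real (Suc i) + 1 = \<gamma> + real N - real i" by simp
  ultimately have "Gamma (\<gamma> + real N - real i) = (\<gamma> + real N - real (Suc i)) * Gamma (\<gamma> + real N - real (Suc i))"
    by (simp only:)
  then show ?thesis by (simp add: beta_moment_def)
qed

section \<open>The moment recursion\<close>

definition lower :: "('i \<Rightarrow> nat) \<Rightarrow> 'i \<Rightarrow> nat \<Rightarrow> 'i \<Rightarrow> nat" where
  "lower m j i = m(j := m j - i)"

lemma sum_lower: "i \<le> m j \<Longrightarrow> sum (lower m j i) UNIV + i = sum m (UNIV :: 'i::finite set)"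
proof -
  assume "i \<le> m j"
  moreover have "sum (lower m j i) UNIV = sum m (UNIV - {j}) + (m j - i)"
    by (subst sum.remove[of _ j]) (auto simp: lower_def intro!: sum.cong)
  ultimately show ?thesis by (subst (2) sum.remove[of _ j]) auto
qed

text \<open>
  Lowering an exponent by one more removes the last factor of one rising factorial in the numerator
  and of the one in the denominator.
\<close>

lemma dirichlet_moment_lower_Suc:
  fixes \<alpha> :: "'d::finite option \<Rightarrow> real"
  assumes "\<And>j. \<alpha> j > 0" "i < m j"
  shows "dirichlet_moment \<alpha> (lower m j (Suc i)) * (\<alpha> j + real (m j - Suc i)) =
     dirichlet_moment \<alpha> (lower m j i) * ((\<Sum>k\<in>UNIV. \<alpha> k) + real (sum m UNIV - Suc i))"
proof -
  let ?A = "\<Sum>k\<in>UNIV. \<alpha> k"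
  have A: "?A > 0" by (intro sum_pos) (auto simp: assms)
  have le: "Suc i \<le> sum m UNIV"
    using assms(2) member_le_sum[of j UNIV m] by simp
  have s: "sum (lower m j i) UNIV = Suc (sum m UNIV - Suc i)" "sum (lower m j (Suc i)) UNIV = sum m UNIV - Suc i"
    using sum_lower[of i m j] sum_lower[of "Suc i" m j] assms(2) le by auto
  let ?P = "\<Prod>k\<in>UNIV - {j}. pochhammer (\<alpha> k) (m k)"
  have p: "(\<Prod>k\<in>UNIV. pochhammer (\<alpha> k) (lower m j i' k)) = pochhammer (\<alpha> j) (m j - i') * ?P" for i'
    by (subst prod.remove[of _ j]) (auto simp: lower_def intro!: prod.cong)
  have "m j - i = Suc (m j - Suc i)" using assms(2) by simp
  then have q: "pochhammer (\<alpha> j) (m j - i) = pochhammer (\<alpha> j) (m j - Suc i) * (\<alpha> j + real (m j - Suc i))"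
    by (simp add: pochhammer_Suc)
  have "pochhammer ?A (sum m UNIV - Suc i) > 0" "?A + real (sum m UNIV - Suc i) > 0"
    using A by (auto intro!: pochhammer_pos)
  then show ?thesis unfolding dirichlet_moment_def p q s by (simp add: pochhammer_Suc)
qed

text \<open>
  The action of one step of the chain on families of moments. The first summand collects the terms
  in which no factor \<open>\<xi>\<close> is chosen in the binomial expansion; there the vertex probabilities add up
  to \<open>1\<close>. In the other terms \<open>\<beta>\<^sub>j\<close> and \<open>(1 - B) x\<^sub>j\<close> come from \<open>p\<^sub>j(x)\<close>, and the factor \<open>x\<^sub>j\<close> raises the
  \<open>j\<close>-th exponent by one, from \<open>m\<^sub>j - i\<close> to \<open>m\<^sub>j - (i - 1)\<close>.
\<close>

definition moment_step ::
    "real \<Rightarrow> ('d::finite option \<Rightarrow> real) \<Rightarrow> (('d option \<Rightarrow> nat) \<Rightarrow> real) \<Rightarrow> ('d option \<Rightarrow> nat) \<Rightarrow> real" where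
  "moment_step \<gamma> \<beta> L m = beta_moment \<gamma> (sum m UNIV) 0 * L m +
     (\<Sum>j\<in>UNIV. \<Sum>i\<in>{1..m j}. real (m j choose i) * beta_moment \<gamma> (sum m UNIV) i *
        (\<beta> j * L (lower m j i) + (1 - (\<Sum>k\<in>UNIV. \<beta> k)) * L (lower m j (i - 1))))"

text \<open>
  With \<open>N = |m|\<close> the first summand of \<open>moment_step\<close> contributes the fraction \<open>\<gamma> / (\<gamma> + N)\<close> of the moment,
  and for each \<open>j\<close> the inner sum contributes the fraction \<open>m\<^sub>j / (\<gamma> + N)\<close>; these fractions add up to \<open>1\<close>.
\<close>

lemma dirichlet_moment_fixed:
  fixes \<beta> :: "'d::finite option \<Rightarrow> real"
  assumes \<gamma>: "\<gamma> > 0" and \<beta>: "\<And>j. \<beta> j > 0"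
  shows "moment_step \<gamma> \<beta> (dirichlet_moment (\<lambda>j. \<beta> j * \<gamma>)) m = dirichlet_moment (\<lambda>j. \<beta> j * \<gamma>) m"
proof -
  define \<alpha> where "\<alpha> = (\<lambda>j. \<beta> j * \<gamma>)"
  define M where "M = dirichlet_moment \<alpha>"
  define N where "N = sum m UNIV"
  define B where "B = (\<Sum>k\<in>UNIV. \<beta> k)"
  have \<alpha>: "\<alpha> j > 0" for j using assms by (simp add: \<alpha>_def)
  have A: "(\<Sum>k\<in>UNIV. \<alpha> k) = B * \<gamma>" by (simp add: \<alpha>_def B_def sum_distrib_right)
  have inner: "(\<Sum>i\<in>{1..m j}. real (m j choose i) * beta_moment \<gamma> N i *
        (\<beta> j * M (lower m j i) + (1 - B) * M (lower m j (i - 1)))) = real (m j) * M m / (\<gamma> + real N)" for j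
  proof -
    \<comment> \<open>The primitive of the telescoping sum: it vanishes at \<open>i = m j\<close>, and its value at \<open>i = 0\<close> is
      \<open>\<gamma>\<close> times the claimed sum.\<close>
    define w where "w i = real (m j - i) * real (m j choose i) * beta_moment \<gamma> N i * M (lower m j i)" for i
    have mN: "m j \<le> N" unfolding N_def using member_le_sum[of j UNIV m] by simp
    have step: "\<gamma> * (real (m j choose Suc i) * beta_moment \<gamma> N (Suc i) *
        (\<beta> j * M (lower m j (Suc i)) + (1 - B) * M (lower m j i))) = w i - w (Suc i)" if i: "i < m j" for i
    proof -
      define r where "r = real (m j - Suc i)"
      define g where "g = \<gamma> + real N - real (Suc i)"
      define a where "a = \<alpha> j"
      have mr: "real (m j - i) = r + 1" using i by (simp add: r_def)
      have "Suc i * (m j choose Suc i) = (m j - i) * (m j choose i)"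
        by (simp only: binomial_absorption binomial_absorb_comp)
      then have b: "real (Suc i) * real (m j choose Suc i) = (r + 1) * real (m j choose i)"
        unfolding mr[symmetric] by (metis of_nat_mult)
      define u where "u = real (m j choose Suc i) * beta_moment \<gamma> N (Suc i)"
      have "u * (\<gamma> + real N - real (Suc i)) = real (m j choose Suc i) * (real (Suc i) * beta_moment \<gamma> N i)"
        using beta_moment_Suc[of \<gamma> i N] i mN \<gamma> by (simp add: u_def del: of_nat_Suc)
      then have bb: "(r + 1) * real (m j choose i) * beta_moment \<gamma> N i = u * g"
        using b by (simp add: g_def mult_ac del: of_nat_Suc)
      have NN: "real (N - Suc i) = g - \<gamma>" using i mN by (simp add: g_def of_nat_diff)
      have M: "(a + r) * M (lower m j (Suc i)) = (B * \<gamma> + (g - \<gamma>)) * M (lower m j i)"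
        using dirichlet_moment_lower_Suc[of \<alpha> i m j] \<alpha> i
        by (simp add: M_def a_def r_def A N_def[symmetric] NN mult.commute)
      have "w i - w (Suc i) = u * g * M (lower m j i) - r * u * M (lower m j (Suc i))"
        unfolding w_def mr bb by (simp add: u_def r_def)
      also have "\<dots> = u * (g * M (lower m j i) - ((a + r) * M (lower m j (Suc i)) - a * M (lower m j (Suc i))))"
        by (simp add: algebra_simps)
      also have "\<dots> = u * (a * M (lower m j (Suc i)) + \<gamma> * (1 - B) * M (lower m j i))"
        unfolding M by (simp add: algebra_simps)
      also have "\<dots> = \<gamma> * (u * (\<beta> j * M (lower m j (Suc i)) + (1 - B) * M (lower m j i)))"
        by (simp add: a_def \<alpha>_def algebra_simps)
      finally show ?thesis by (simp add: u_def)
    qed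
    have "\<gamma> * (\<Sum>i\<in>{1..m j}. real (m j choose i) * beta_moment \<gamma> N i *
        (\<beta> j * M (lower m j i) + (1 - B) * M (lower m j (i - 1)))) =
        (\<Sum>i<m j. \<gamma> * (real (m j choose Suc i) * beta_moment \<gamma> N (Suc i) *
        (\<beta> j * M (lower m j (Suc i)) + (1 - B) * M (lower m j i))))"
      by (simp add: sum.atLeast1_atMost_eq sum_distrib_left)
    also have "\<dots> = (\<Sum>i<m j. w i - w (Suc i))" by (intro sum.cong refl step) auto
    also have "\<dots> = w 0 - w (m j)" by (rule sum_lessThan_telescope')
    also have "\<dots> = \<gamma> * (real (m j) * M m / (\<gamma> + real N))"
      using \<gamma> by (simp add: w_def beta_moment_0 lower_def)
    finally show ?thesis
      using mult_left_cancel[of \<gamma>] \<gamma> by blast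
  qed
  have "moment_step \<gamma> \<beta> M m = beta_moment \<gamma> N 0 * M m + (\<Sum>j\<in>UNIV. real (m j) * M m / (\<gamma> + real N))"
    unfolding moment_step_def N_def[symmetric] B_def[symmetric] inner ..
  also have "(\<Sum>j\<in>UNIV. real (m j) * M m / (\<gamma> + real N)) = real N * M m / (\<gamma> + real N)"
    by (simp add: N_def sum_divide_distrib sum_distrib_right)
  also have "beta_moment \<gamma> N 0 * M m + real N * M m / (\<gamma> + real N) = M m"
  proof -
    have "\<gamma> + real N \<noteq> 0" using \<gamma> by simp
    then show ?thesis
      using \<gamma> by (simp add: beta_moment_0 add_divide_distrib[symmetric] distrib_right[symmetric])
  qed
  finally show ?thesis unfolding M_def \<alpha>_def .
qed

lemma affine_recursion_tendsto_0:
  fixes x e :: "nat \<Rightarrow> real"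
  assumes rec: "\<And>n. x (Suc n) = q * x n + e n" and "\<bar>q\<bar> < 1" and "e \<longlonglongrightarrow> 0"
  shows "x \<longlonglongrightarrow> 0"
proof (rule LIMSEQ_I)
  fix r :: real assume r: "r > 0"
  \<comment> \<open>Chosen so that \<open>r / 2\<close> is the fixed point of \<open>y \<mapsto> \<bar>q\<bar> y + s\<close>.\<close>
  define s where "s = (1 - \<bar>q\<bar>) * r / 2"
  have s: "s > 0" using r assms by (simp add: s_def)
  obtain n0 where n0: "\<And>n. n \<ge> n0 \<Longrightarrow> \<bar>e n\<bar> < s"
    using LIMSEQ_D[OF assms(3) s] by auto
  have bound: "\<bar>x (n0 + k)\<bar> \<le> \<bar>q\<bar> ^ k * \<bar>x n0\<bar> + r / 2" for k
  proof (induction k)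
    case 0 then show ?case using r by simp
  next
    case (Suc k)
    have "\<bar>x (n0 + Suc k)\<bar> \<le> \<bar>q\<bar> * \<bar>x (n0 + k)\<bar> + \<bar>e (n0 + k)\<bar>"
      using abs_triangle_ineq[of "q * x (n0 + k)" "e (n0 + k)"] by (simp add: rec abs_mult)
    also have "\<dots> \<le> \<bar>q\<bar> * (\<bar>q\<bar> ^ k * \<bar>x n0\<bar> + r / 2) + s"
      using n0[of "n0 + k"] by (intro add_mono mult_left_mono Suc) auto
    also have "\<dots> = \<bar>q\<bar> ^ Suc k * \<bar>x n0\<bar> + r / 2"
      by (simp add: s_def algebra_simps) (simp add: field_simps)
    finally show ?case .
  qed
  have "(\<lambda>k. \<bar>q\<bar> ^ k * \<bar>x n0\<bar>) \<longlonglongrightarrow> 0 * \<bar>x n0\<bar>"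
    using assms by (intro tendsto_intros LIMSEQ_power_zero) auto
  then obtain k0 where k0: "\<And>k. k \<ge> k0 \<Longrightarrow> \<bar>q\<bar> ^ k * \<bar>x n0\<bar> < r / 2"
    using LIMSEQ_D[of _ 0 "r / 2"] r by (fastforce simp: abs_mult)
  have "\<bar>x n\<bar> < r" if "n \<ge> n0 + k0" for n
  proof -
    have "\<bar>x n\<bar> \<le> \<bar>q\<bar> ^ (n - n0) * \<bar>x n0\<bar> + r / 2" using bound[of "n - n0"] that by simp
    moreover have "\<bar>q\<bar> ^ (n - n0) * \<bar>x n0\<bar> < r / 2" using that by (intro k0) simp
    ultimately show ?thesis by linarith
  qed
  then show "\<exists>no. \<forall>n\<ge>no. norm (x n - 0) < r" by auto
qed

text \<open>
  The diagonal entry equals \<open>\<gamma> (\<gamma> + N - 1 + N (1 - B)) / ((\<gamma> + N) (\<gamma> + N - 1))\<close>. At the two ends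
  \<open>B = 0\<close> and \<open>B = 2\<close> of the admissible range its numerator is \<open>\<gamma> (\<gamma> + 2 N - 1)\<close> and \<open>\<gamma> (\<gamma> - 1)\<close>,
  neither of which exceeds the denominator in modulus; in between the numerator is strictly
  decreasing in \<open>B\<close>, which makes the inequality strict.
\<close>

lemma moment_factor_less_1:
  fixes B \<gamma> :: real and N :: nat
  assumes "\<gamma> > 0" "0 < B" "B < 2" "N > 0"
  shows "\<bar>beta_moment \<gamma> N 0 + real N * beta_moment \<gamma> N 1 * (1 - B)\<bar> < 1"
proof -
  define n where "n = real N"
  have n: "n \<ge> 1" using assms by (simp add: n_def)
  have g: "\<gamma> + n - 1 > 0" "\<gamma> + n > 0" using n assms by auto
  have c1: "beta_moment \<gamma> N 1 = \<gamma> / ((\<gamma> + n) * (\<gamma> + n - 1))"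
    using beta_moment_Suc[of \<gamma> 0 N] assms g
    by (simp add: beta_moment_0 n_def[symmetric] eq_divide_eq mult_ac)
  have eq: "beta_moment \<gamma> N 0 + real N * beta_moment \<gamma> N 1 * (1 - B) =
     \<gamma> * (\<gamma> + n - 1 + n * (1 - B)) / ((\<gamma> + n) * (\<gamma> + n - 1))"
    unfolding c1 using g assms by (simp add: beta_moment_0 n_def[symmetric] divide_simps) (simp add: algebra_simps)
  have pos: "(\<gamma> + n) * (\<gamma> + n - 1) > 0" using g by simp
  have nB: "0 < \<gamma> * (n * B)" "\<gamma> * (n * B) < \<gamma> * (n * 2)" using n assms by auto
  have sq: "n * n \<ge> n" using n by simp
  have "\<gamma> * (\<gamma> + n - 1 + n * (1 - B)) < (\<gamma> + n) * (\<gamma> + n - 1)"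
    using nB sq by (simp add: algebra_simps)
  moreover have "\<gamma> * (\<gamma> + n - 1 + n * (1 - B)) > - ((\<gamma> + n) * (\<gamma> + n - 1))"
  proof -
    have "\<gamma> * (\<gamma> + n - 1 + n * (1 - B)) > \<gamma> * (\<gamma> - 1)"
      using nB by (simp add: algebra_simps)
    moreover have "\<gamma> * (\<gamma> - 1) + (\<gamma> + n) * (\<gamma> + n - 1) \<ge> 0"
    proof -
      have "\<gamma> * (\<gamma> - 1) + (\<gamma> + n) * (\<gamma> + n - 1) = 2 * \<gamma> * \<gamma> + 2 * (\<gamma> * (n - 1)) + (n * n - n)"
        by (simp add: algebra_simps)
      then show ?thesis using sq n assms by simp
    qed
    ultimately show ?thesis by linarith
  qed
  ultimately have "\<bar>\<gamma> * (\<gamma> + n - 1 + n * (1 - B))\<bar> < (\<gamma> + n) * (\<gamma> + n - 1)" by linarith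
  then show ?thesis unfolding eq using pos by (simp add: abs_divide)
qed

text \<open>
  In degree \<open>N\<close> the recursion reads \<open>D (n + 1) m = q D n m + e n\<close>, where \<open>e n\<close> involves only moments of
  lower degree and hence tends to \<open>0\<close> by induction, and \<open>|q| < 1\<close>.
\<close>

lemma moment_iteration_tendsto_0:
  fixes D :: "nat \<Rightarrow> ('d::finite option \<Rightarrow> nat) \<Rightarrow> real"
  assumes \<gamma>: "\<gamma> > 0" and B: "0 < sum \<beta> UNIV" "sum \<beta> UNIV < 2"
    and step: "\<And>n m. D (Suc n) m = moment_step \<gamma> \<beta> (D n) m"
    and zero: "\<And>n m. sum m UNIV = 0 \<Longrightarrow> D n m = 0"
  shows "(\<lambda>n. D n m) \<longlonglongrightarrow> 0"
proof (induction "sum m UNIV" arbitrary: m rule: less_induct)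
  case less
  define N where "N = sum m UNIV"
  define B where "B = sum \<beta> UNIV"
  show ?case
  proof (cases "N = 0")
    case True
    then show ?thesis by (simp add: zero N_def)
  next
    case False
    \<comment> \<open>Besides the leading summand, the terms with \<open>i = 1\<close> contain the moment \<open>m\<close> itself, since
      lowering an exponent by \<open>i - 1 = 0\<close> does nothing; \<open>q\<close> collects both and \<open>e\<close> the rest.\<close>
    define q where "q = beta_moment \<gamma> N 0 + real N * beta_moment \<gamma> N 1 * (1 - B)"
    define e where "e n = (\<Sum>j\<in>UNIV. \<Sum>i\<in>{1..m j}. real (m j choose i) * beta_moment \<gamma> N i *
        (\<beta> j * D n (lower m j i) + (1 - B) * (if i = 1 then 0 else D n (lower m j (i - 1)))))" for n
    have lim: "(\<lambda>n. D n (lower m j i)) \<longlonglongrightarrow> 0" if "1 \<le> i" "i \<le> m j" for i j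
      using sum_lower[of i m j] that by (intro less.hyps) auto
    have "e \<longlonglongrightarrow> (\<Sum>j\<in>UNIV. \<Sum>i\<in>{1..m j}. real (m j choose i) * beta_moment \<gamma> N i *
        (\<beta> j * 0 + (1 - B) * 0))"
    proof -
      have "(\<lambda>n. if i = 1 then 0 else D n (lower m j (i - 1))) \<longlonglongrightarrow> 0" if "i \<in> {1..m j}" for i j
        using lim[of "i - 1" j] that by (cases "i = 1") auto
      then show ?thesis unfolding e_def using lim by (intro tendsto_intros) auto
    qed
    then have e: "e \<longlonglongrightarrow> 0" by simp
    have "D (Suc n) m = q * D n m + e n" for n
    proof -
      have inner: "(\<Sum>i\<in>{1..m j}. real (m j choose i) * beta_moment \<gamma> N i *
          (\<beta> j * D n (lower m j i) + (1 - B) * D n (lower m j (i - 1)))) =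
        (\<Sum>i\<in>{1..m j}. real (m j choose i) * beta_moment \<gamma> N i *
          (\<beta> j * D n (lower m j i) + (1 - B) * (if i = 1 then 0 else D n (lower m j (i - 1))))) +
        real (m j) * (beta_moment \<gamma> N 1 * (1 - B) * D n m)" (is "?lhs = ?rhs + ?top") for j
      proof -
        have "?lhs = ?rhs + (\<Sum>i\<in>{1..m j}. if i = 1 then ?top else 0)"
          unfolding sum.distrib[symmetric] by (intro sum.cong) (auto simp: lower_def algebra_simps)
        also have "(\<Sum>i\<in>{1..m j}. if i = 1 then ?top else 0) = ?top"
          by (cases "m j = 0") auto
        finally show ?thesis .
      qed
      have "D (Suc n) m = beta_moment \<gamma> N 0 * D n m + (e n +
          (\<Sum>j\<in>UNIV. real (m j) * (beta_moment \<gamma> N 1 * (1 - B) * D n m)))"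
        unfolding step moment_step_def N_def[symmetric] B_def[symmetric] e_def inner sum.distrib ..
      also have "(\<Sum>j\<in>UNIV. real (m j) * (beta_moment \<gamma> N 1 * (1 - B) * D n m)) =
          real N * (beta_moment \<gamma> N 1 * (1 - B) * D n m)"
        unfolding N_def of_nat_sum sum_distrib_right ..
      finally show ?thesis by (simp add: q_def algebra_simps)
    qed
    moreover have "\<bar>q\<bar> < 1"
      unfolding q_def using False B \<gamma> by (intro moment_factor_less_1) (auto simp: B_def)
    ultimately show ?thesis using e by (rule affine_recursion_tendsto_0)
  qed
qed

section \<open>Moments and weak convergence on the simplex\<close>

text \<open>
  The linear span of the monomials, generated in such a way that a statement about integrals follows
  by induction from its case of a single monomial. Closed under products, it is the algebra to
  which the Stone-Weierstrass theorem is applied.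
\<close>

inductive_set bary_polys :: "(real ^ 'd::finite \<Rightarrow> real) set" where
  mono: "(\<lambda>z. c * bary_monomial m z) \<in> bary_polys"
| add: "f \<in> bary_polys \<Longrightarrow> g \<in> bary_polys \<Longrightarrow> (\<lambda>z. f z + g z) \<in> bary_polys"

lemma bary_monomial_mult: "bary_monomial m z * bary_monomial m' z = bary_monomial (\<lambda>j. m j + m' j) z"
  by (simp add: bary_monomial_def prod.distrib power_add)

lemma bary_polys_mult:
  assumes "f \<in> bary_polys" "g \<in> bary_polys"
  shows "(\<lambda>z. f z * g z) \<in> bary_polys"
  using assms(1)
proof induction
  case (mono c m)
  show ?case using assms(2)
  proof induction
    case (mono c' m')
    have "(\<lambda>z. c * bary_monomial m z * (c' * bary_monomial m' z)) = (\<lambda>z. (c * c') * bary_monomial (\<lambda>j. m j + m' j) z)"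
      by (simp add: bary_monomial_mult[symmetric] mult_ac)
    then show ?case by (simp only: bary_polys.mono)
  next
    case (add f g)
    then show ?case by (simp only: distrib_left bary_polys.add)
  qed
next
  case (add f g)
  then show ?case by (simp only: distrib_right bary_polys.add)
qed

lemma bary_monomial_0: "bary_monomial (\<lambda>_. 0) z = 1"
  by (simp add: bary_monomial_def)

lemma bary_monomial_single: "bary_monomial (\<lambda>k. if k = j then 1 else 0) z = bary z j"
  by (simp add: bary_monomial_def if_distrib cong: if_cong)

lemma continuous_on_bary_polys: "f \<in> bary_polys \<Longrightarrow> continuous_on S f"
  by (induction rule: bary_polys.induct) (intro continuous_intros continuous_on_bary_monomial; assumption)+

lemma bary_polys_dense:
  fixes f :: "real ^ 'd::finite \<Rightarrow> real"
  assumes "continuous_on orth_simplex f" "e > 0"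
  shows "\<exists>g\<in>bary_polys. \<forall>z\<in>orth_simplex. \<bar>f z - g z\<bar> < e"
proof -
  interpret function_ring_on "bary_polys :: (real ^ 'd \<Rightarrow> real) set" orth_simplex
  proof
    show "(\<lambda>_. c) \<in> bary_polys" for c
      using bary_polys.mono[of c "\<lambda>_. 0"] by (simp add: bary_monomial_0)
  next
    fix x y :: "real ^ 'd" assume "x \<noteq> y"
    then obtain k where "bary x (Some k) \<noteq> bary y (Some k)" by (auto simp: vec_eq_iff bary_def)
    then show "\<exists>f\<in>bary_polys. f x \<noteq> f y"
      using bary_polys.mono[of 1 "\<lambda>i. if i = Some k then 1 else 0"]
      by (intro bexI[of _ "\<lambda>z. 1 * bary_monomial (\<lambda>i. if i = Some k then 1 else 0) z"]) (simp_all add: bary_monomial_single)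
  qed (auto intro: compact_orth_simplex continuous_on_bary_polys bary_polys.add bary_polys_mult)
  show ?thesis using Stone_Weierstrass_basic assms by blast
qed

lemma bary_monomial_bounds: "z \<in> orth_simplex \<Longrightarrow> 0 \<le> bary_monomial m z \<and> bary_monomial m z \<le> 1"
  unfolding bary_monomial_def using bary_le_1[of z]
  by (auto simp: orth_simplex_iff_bary intro!: prod_nonneg prod_le_1 power_le_one)

lemma integrable_bary_monomial:
  assumes "prob_space M" "Z \<in> borel_measurable M" "AE \<omega> in M. Z \<omega> \<in> orth_simplex"
  shows "integrable M (\<lambda>\<omega>. bary_monomial m (Z \<omega>))"
proof -
  interpret prob_space M by fact
  note [measurable] = assms(2)
  show ?thesis
    by (rule integrable_const_bound[where B = 1]) (use assms(3) in \<open>auto simp: bary_monomial_bounds\<close>)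
qed

text \<open>
  All the laws live on the compact simplex, so replacing a continuous test function by a uniformly
  close polynomial changes its integrals by a uniformly small amount.
\<close>

lemma converges_weakly_of_moments:
  fixes \<mu> :: "(real ^ 'd::finite) measure"
  assumes \<mu>: "prob_space \<mu>" "sets \<mu> = sets borel" "AE z in \<mu>. z \<in> orth_simplex"
    and \<mu>s: "\<And>n. prob_space (\<mu>s n)" "\<And>n. sets (\<mu>s n) = sets borel" "\<And>n. AE z in \<mu>s n. z \<in> orth_simplex"
    and lim: "\<And>m. (\<lambda>n. integral\<^sup>L (\<mu>s n) (bary_monomial m)) \<longlonglongrightarrow> integral\<^sup>L \<mu> (bary_monomial m)"
  shows "converges_weakly \<mu>s \<mu>"
  unfolding converges_weakly_def
proof (intro allI impI)
  fix f :: "real ^ 'd \<Rightarrow> real"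
  assume f: "continuous_on UNIV f" "bounded (range f)"
  have meas: "g \<in> borel_measurable M" if "sets M = sets borel" "g \<in> borel_measurable borel"
    for M :: "(real ^ 'd) measure" and g :: "real ^ 'd \<Rightarrow> real"
    using that measurable_cong_sets by blast
  have int_f: "integrable M f" if M: "prob_space M" "sets M = sets borel" for M
  proof -
    interpret prob_space M by fact
    obtain b where "\<And>x. norm (f x) \<le> b" using f(2) by (auto simp: bounded_iff)
    then show ?thesis
      using meas[OF M(2) borel_measurable_continuous_onI[OF f(1)]] by (intro integrable_const_bound[where B = b]) auto
  qed
  have int_g: "integrable M g" if M: "prob_space M" "sets M = sets borel" "AE z in M. z \<in> orth_simplex"
    and "g \<in> bary_polys" for M :: "(real ^ 'd) measure" and g
    using that(4)
  proof induction
    case (mono c m)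
    then show ?case using integrable_bary_monomial[OF M(1) _ M(3)] meas[OF M(2) borel_measurable_bary_monomial] M(2)
      by (auto simp: measurable_cong_sets[OF M(2)])
  qed auto
  have lim_g: "(\<lambda>n. integral\<^sup>L (\<mu>s n) g) \<longlonglongrightarrow> integral\<^sup>L \<mu> g" if "g \<in> bary_polys" for g
    using that
  proof induction
    case (mono c m)
    then show ?case by (simp add: tendsto_mult_left lim)
  next
    case (add f g)
    then show ?case by (simp add: int_g \<mu> \<mu>s tendsto_add)
  qed
  have close: "\<bar>integral\<^sup>L M f - integral\<^sup>L M g\<bar> \<le> e"
    if M: "prob_space M" "sets M = sets borel" "AE z in M. z \<in> orth_simplex"
    and g: "g \<in> bary_polys" "\<forall>z\<in>orth_simplex. \<bar>f z - g z\<bar> < e" for M g e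
  proof -
    interpret prob_space M by fact
    have "\<bar>integral\<^sup>L M f - integral\<^sup>L M g\<bar> = \<bar>\<integral>z. f z - g z \<partial>M\<bar>"
      using int_f[OF M(1,2)] int_g[OF M g(1)] by simp
    also have "\<dots> \<le> (\<integral>z. \<bar>f z - g z\<bar> \<partial>M)" by (rule integral_abs_bound)
    also have "\<dots> \<le> (\<integral>z. e \<partial>M)"
      using int_f[OF M(1,2)] int_g[OF M g(1)] M(3) g(2)
      by (intro integral_mono_AE) (auto elim!: eventually_mono intro: less_imp_le)
    finally show ?thesis by (simp add: prob_space)
  qed
  show "(\<lambda>n. integral\<^sup>L (\<mu>s n) f) \<longlonglongrightarrow> integral\<^sup>L \<mu> f"
  proof (rule LIMSEQ_I)
    fix r :: real assume r: "r > 0"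
    obtain g where g: "g \<in> bary_polys" "\<forall>z\<in>orth_simplex. \<bar>f z - g z\<bar> < r / 3"
      using bary_polys_dense[of f "r / 3"] f(1) r continuous_on_subset by (metis divide_pos_pos top_greatest zero_less_numeral)
    obtain n0 where n0: "\<And>n. n \<ge> n0 \<Longrightarrow> \<bar>integral\<^sup>L (\<mu>s n) g - integral\<^sup>L \<mu> g\<bar> < r / 3"
      using LIMSEQ_D[OF lim_g[OF g(1)], of "r / 3"] r by auto
    have "\<bar>integral\<^sup>L (\<mu>s n) f - integral\<^sup>L \<mu> f\<bar> < r" if "n \<ge> n0" for n
      using n0[OF that] close[OF \<mu> g] close[OF \<mu>s g, of n] by linarith
    then show "\<exists>no. \<forall>n\<ge>no. norm (integral\<^sup>L (\<mu>s n) f - integral\<^sup>L \<mu> f) < r" by auto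
  qed
qed

text \<open>
  The indicator of a nonempty closed set \<open>C\<close> is the decreasing limit of the functions
  \<open>max 0 (1 - k dist(x, C))\<close>, and the closed sets form an intersection-stable generator.
\<close>

lemma prob_measure_eqI_continuous:
  fixes M N :: "'a::metric_space measure"
  assumes M: "prob_space M" "sets M = sets borel" and N: "prob_space N" "sets N = sets borel"
    and eq: "\<And>f :: 'a \<Rightarrow> real. continuous_on UNIV f \<Longrightarrow> bounded (range f) \<Longrightarrow> integral\<^sup>L M f = integral\<^sup>L N f"
  shows "M = N"
proof -
  have lim: "(\<lambda>k. \<integral>x. max 0 (1 - real k * infdist x C) \<partial>M) \<longlonglongrightarrow> measure M C"
    if M: "prob_space M" "sets M = sets borel" and C: "closed C" "C \<noteq> {}" for C and M :: "'a measure"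
  proof -
    interpret prob_space M by fact
    note [measurable_cong] = M(2)
    have [measurable]: "C \<in> sets borel" using C by auto
    have [measurable]: "(\<lambda>x. infdist x C) \<in> borel_measurable borel"
      by (intro borel_measurable_continuous_onI continuous_intros)
    have "(\<lambda>k. \<integral>x. max 0 (1 - real k * infdist x C) \<partial>M) \<longlonglongrightarrow> (\<integral>x. indicator C x \<partial>M)"
    proof (rule integral_dominated_convergence[where w = "\<lambda>_. 1"])
      have "(\<lambda>k. max 0 (1 - real k * infdist x C)) \<longlonglongrightarrow> indicator C x" for x
      proof (cases "x \<in> C")
        case False
        then have pos: "infdist x C > 0" using C infdist_pos_not_in_closed by blast
        obtain k0 where "1 / infdist x C < real k0" using reals_Archimedean2 by blast
        then have "max 0 (1 - real k * infdist x C) = 0" if "k \<ge> k0" for k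
          using that pos by (simp add: pos_divide_less_eq max_def)
            (meson less_eq_real_def mult_right_mono of_nat_le_iff order.strict_trans1 not_less order_trans)
        then show ?thesis using False
          by (intro tendsto_eventually eventually_sequentiallyI[of k0]) auto
      qed simp
      then show "AE x in M. (\<lambda>k. max 0 (1 - real k * infdist x C)) \<longlonglongrightarrow> indicator C x" by simp
    qed (auto simp: infdist_nonneg)
    moreover have "(\<integral>x. indicator C x \<partial>M) = measure M C"
      using M(2) sets_eq_imp_space_eq[OF M(2)] by simp
    ultimately show ?thesis by simp
  qed
  have meq: "measure M C = measure N C" if "closed C" for C
  proof (cases "C = {}")
    case False
    have "(\<integral>x. max 0 (1 - real k * infdist x C) \<partial>M) = (\<integral>x. max 0 (1 - real k * infdist x C) \<partial>N)" for k
      by (rule eq) (auto intro!: continuous_intros boundedI[where B = 1] simp: infdist_nonneg)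
    then show ?thesis
      using lim[OF M that False] lim[OF N that False] LIMSEQ_unique by simp
  qed simp
  interpret M: prob_space M by fact
  interpret N: prob_space N by fact
  show ?thesis
  proof (rule measure_eqI_generator_eq[where E = "Collect closed" and \<Omega> = UNIV and A = "\<lambda>_. UNIV"])
    show "Int_stable (Collect closed :: 'a set set)" by (auto simp: Int_stable_def)
    show "sets M = sigma_sets UNIV (Collect closed)" "sets N = sigma_sets UNIV (Collect closed)"
      using M(2) N(2) by (simp_all add: borel_eq_closed)
  qed (auto simp: M.emeasure_eq_measure N.emeasure_eq_measure meq)
qed

text \<open>A constant sequence of laws has only one weak limit.\<close>

lemma prob_measure_eqI_moments:
  fixes M N :: "(real ^ 'd::finite) measure"
  assumes M: "prob_space M" "sets M = sets borel" "AE z in M. z \<in> orth_simplex"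
    and N: "prob_space N" "sets N = sets borel" "AE z in N. z \<in> orth_simplex"
    and eq: "\<And>m. integral\<^sup>L M (bary_monomial m) = integral\<^sup>L N (bary_monomial m)"
  shows "M = N"
proof (rule prob_measure_eqI_continuous[OF M(1,2) N(1,2)])
  have "converges_weakly (\<lambda>_. M) N"
    by (rule converges_weakly_of_moments) (use M N eq in auto)
  then show "integral\<^sup>L M f = integral\<^sup>L N f" if "continuous_on UNIV f" "bounded (range f)"
    for f :: "real ^ 'd \<Rightarrow> real"
    using that LIMSEQ_const_iff by (auto simp: converges_weakly_def)
qed

section \<open>One step of the chain\<close>

lemma bary_vertex: "bary (vertex i) j = (if i = j then 1 else 0)"
  by (cases i; cases j) (auto simp: bary_def vertex_def axis_def)

lemma vertex_eq_iff: "vertex i = vertex j \<longleftrightarrow> i = j"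
  using bary_vertex by (metis zero_neq_one)

lemma vertex_in_simplex: "vertex j \<in> orth_simplex"
  by (simp add: orth_simplex_iff_bary bary_vertex)

lemma bary_convex_comb: "bary ((1 - t) *\<^sub>R z + t *\<^sub>R w) j = (1 - t) * bary z j + t * bary w j"
proof (cases j)
  case None
  have "(\<Sum>k\<in>UNIV. ((1 - t) *\<^sub>R z + t *\<^sub>R w) $ k) = (1 - t) * (\<Sum>k\<in>UNIV. z $ k) + t * (\<Sum>k\<in>UNIV. w $ k)"
    by (simp add: sum.distrib sum_distrib_left)
  then show ?thesis unfolding None bary_def option.case by (simp only:) (simp add: algebra_simps)
qed (simp add: bary_def)

lemma convex_comb_in_simplex:
  "z \<in> orth_simplex \<Longrightarrow> w \<in> orth_simplex \<Longrightarrow> 0 \<le> t \<Longrightarrow> t \<le> 1 \<Longrightarrow> (1 - t) *\<^sub>R z + t *\<^sub>R w \<in> orth_simplex"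
  by (simp add: orth_simplex_iff_bary bary_convex_comb)

text \<open>The form of \<open>p\<^sub>j\<close> in which the index \<open>0\<close> behaves like all the others.\<close>

lemma vertex_prob_linear_p:
  "vertex_prob (linear_p \<beta>) j z = \<beta> j + (1 - (\<Sum>k\<in>UNIV. \<beta> k)) * bary z j"
proof (cases j)
  case None
  have "linear_p \<beta> z $ k = \<beta> (Some k) + (1 - (\<Sum>j\<in>UNIV. \<beta> j)) * z $ k" for k
    by (simp add: linear_p_def algebra_simps)
  then have "(\<Sum>k\<in>UNIV. linear_p \<beta> z $ k) = (\<Sum>k\<in>UNIV. \<beta> (Some k)) + (1 - (\<Sum>j\<in>UNIV. \<beta> j)) * (\<Sum>k\<in>UNIV. z $ k)"
    by (simp only: sum.distrib sum_distrib_left)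
  then show ?thesis
    using None by (simp add: vertex_prob_def bary_def sum_option_UNIV algebra_simps)
next
  case (Some k)
  then show ?thesis by (simp add: vertex_prob_def bary_def linear_p_def algebra_simps)
qed

lemma bary_linear_p: "bary (linear_p \<beta> z) j = vertex_prob (linear_p \<beta>) j z"
  by (simp add: bary_def vertex_prob_def)

lemma linear_p_in_simplex:
  fixes \<beta> :: "'d::finite option \<Rightarrow> real"
  assumes "\<And>k. \<beta> k > 0" "\<And>k. (\<Sum>j\<in>UNIV. \<beta> j) - \<beta> k < 1" "z \<in> orth_simplex"
  shows "linear_p \<beta> z \<in> orth_simplex"
  unfolding orth_simplex_iff_bary bary_linear_p
proof
  fix j
  have b: "0 \<le> bary z j" "bary z j \<le> 1" using assms(3) by (auto simp: orth_simplex_iff_bary bary_le_1)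
  \<comment> \<open>A convex combination of two values that the hypotheses on \<open>\<beta>\<close> make positive.\<close>
  have "vertex_prob (linear_p \<beta>) j z = \<beta> j * (1 - bary z j) + (1 - ((\<Sum>k\<in>UNIV. \<beta> k) - \<beta> j)) * bary z j"
    by (simp add: vertex_prob_linear_p algebra_simps)
  also have "\<dots> \<ge> 0"
    using b assms(1)[of j] assms(2)[of j] by (intro add_nonneg_nonneg mult_nonneg_nonneg) auto
  finally show "0 \<le> vertex_prob (linear_p \<beta>) j z" .
qed

text \<open>
  Two distinct indices exist because \<open>d \<ge> 1\<close>. Adding the hypotheses for them gives
  \<open>2 B - (\<beta>\<^sub>j + \<beta>\<^sub>k) < 2\<close>, and \<open>\<beta>\<^sub>j + \<beta>\<^sub>k \<le> B\<close>.
\<close>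

lemma sum_beta_less_2:
  fixes \<beta> :: "'d::finite option \<Rightarrow> real"
  assumes "\<And>k. \<beta> k > 0" "\<And>k. (\<Sum>j\<in>UNIV. \<beta> j) - \<beta> k < 1"
  shows "(\<Sum>j\<in>UNIV. \<beta> j) < 2"
proof -
  obtain k :: 'd where True by simp
  have "\<beta> None + \<beta> (Some k) \<le> (\<Sum>j\<in>UNIV. \<beta> j)"
    using sum_mono2[of UNIV "{None, Some k}" \<beta>] assms(1) by (auto intro: less_imp_le)
  then show ?thesis using assms(2)[of None] assms(2)[of "Some k"] by linarith
qed

lemma bary_mult_bary_monomial_lower:
  assumes "1 \<le> i" "i \<le> m j"
  shows "bary z j * bary_monomial (lower m j i) z = bary_monomial (lower m j (i - 1)) z"
proof -
  have "bary_monomial (lower m j i') z = bary z j ^ (m j - i') * (\<Prod>k\<in>UNIV - {j}. bary z k ^ m k)" for i'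
    unfolding bary_monomial_def by (subst prod.remove[of _ j]) (auto simp: lower_def intro!: prod.cong)
  moreover have "m j - (i - 1) = Suc (m j - i)" using assms by simp
  ultimately show ?thesis by simp
qed

lemma bary_monomial_towards_vertex:
  "bary_monomial m ((1 - x) *\<^sub>R z + x *\<^sub>R vertex j) =
    (\<Sum>i\<le>m j. real (m j choose i) * (bary_monomial (lower m j i) z * ((1 - x) ^ (sum m UNIV - i) * x ^ i)))"
proof -
  define R where "R = (\<Prod>k\<in>UNIV - {j}. bary z k ^ m k)"
  have N: "sum m UNIV = m j + sum m (UNIV - {j})" by (rule sum.remove) auto
  have low: "bary_monomial (lower m j i) z = bary z j ^ (m j - i) * R" for i
    unfolding bary_monomial_def R_def by (subst prod.remove[of _ j]) (auto simp: lower_def intro!: prod.cong)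
  have "bary_monomial m ((1 - x) *\<^sub>R z + x *\<^sub>R vertex j) =
     ((1 - x) * bary z j + x) ^ m j * (\<Prod>k\<in>UNIV - {j}. ((1 - x) * bary z k) ^ m k)"
    unfolding bary_monomial_def bary_convex_comb bary_vertex
    by (subst prod.remove[of _ j]) (auto intro!: prod.cong)
  also have "(\<Prod>k\<in>UNIV - {j}. ((1 - x) * bary z k) ^ m k) = (1 - x) ^ sum m (UNIV - {j}) * R"
    by (simp add: R_def power_mult_distrib prod.distrib power_sum)
  also have "((1 - x) * bary z j + x) ^ m j =
     (\<Sum>i\<le>m j. real (m j choose i) * x ^ i * ((1 - x) * bary z j) ^ (m j - i))"
    by (subst add.commute, rule binomial_ring)
  also have "\<dots> * ((1 - x) ^ sum m (UNIV - {j}) * R) =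
     (\<Sum>i\<le>m j. real (m j choose i) * (bary_monomial (lower m j i) z * ((1 - x) ^ (sum m UNIV - i) * x ^ i)))"
    unfolding sum_distrib_right
  proof (intro sum.cong refl)
    fix i assume "i \<in> {..m j}"
    then have "sum m UNIV - i = (m j - i) + sum m (UNIV - {j})" using N by simp
    then show "real (m j choose i) * x ^ i * ((1 - x) * bary z j) ^ (m j - i) * ((1 - x) ^ sum m (UNIV - {j}) * R) =
      real (m j choose i) * (bary_monomial (lower m j i) z * ((1 - x) ^ (sum m UNIV - i) * x ^ i))"
      by (simp add: low power_mult_distrib power_add mult_ac)
  qed
  finally show ?thesis .
qed

text \<open>
  All that the moment computation needs about the dependence between \<open>Z\<close>, \<open>\<xi>\<close> and \<open>\<Theta>\<close>. A single random step and
  a step inside the chain satisfy it for different reasons: in the first \<open>\<Theta>\<close> is conditioned on \<open>Z\<close>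
  alone and \<open>\<xi>\<close> is independent of the pair, in the second \<open>\<Theta>\<close> is conditioned on \<open>\<xi>\<close> as well.
\<close>

definition step_factorizes ::
  "'a measure \<Rightarrow> ('a \<Rightarrow> real ^ 'd::finite) \<Rightarrow> ('a \<Rightarrow> real) \<Rightarrow> ('a \<Rightarrow> real ^ 'd) \<Rightarrow> (real ^ 'd \<Rightarrow> real ^ 'd) \<Rightarrow> bool" where
  "step_factorizes M Z \<xi> \<Theta> p \<longleftrightarrow> (\<forall>j. \<forall>g\<in>borel_measurable borel. \<forall>h\<in>borel_measurable borel.
     (AE \<omega> in M. \<bar>g (Z \<omega>)\<bar> \<le> 1) \<longrightarrow> (AE \<omega> in M. \<bar>h (\<xi> \<omega>)\<bar> \<le> 1) \<longrightarrow>
     (\<integral>\<omega>. indicator {\<omega>\<in>space M. \<Theta> \<omega> = vertex j} \<omega> * (g (Z \<omega>) * h (\<xi> \<omega>)) \<partial>M) =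
     (\<integral>\<omega>. vertex_prob p j (Z \<omega>) * g (Z \<omega>) \<partial>M) * (\<integral>\<omega>. h (\<xi> \<omega>) \<partial>M))"

lemma independent_rvs_integral_mult:
  fixes f :: "'b \<Rightarrow> real" and g :: "'c \<Rightarrow> real"
  assumes "prob_space M" and ind: "independent_rvs M N X K Y"
    and f: "f \<in> borel_measurable N" and g: "g \<in> borel_measurable K"
    and int: "integrable M (\<lambda>\<omega>. f (X \<omega>))" "integrable M (\<lambda>\<omega>. g (Y \<omega>))"
  shows "(\<integral>\<omega>. f (X \<omega>) * g (Y \<omega>) \<partial>M) = (\<integral>\<omega>. f (X \<omega>) \<partial>M) * (\<integral>\<omega>. g (Y \<omega>) \<partial>M)"
proof -
  interpret prob_space M by fact
  have X: "X \<in> measurable M N" and Y: "Y \<in> measurable M K"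
    and ind: "indep_set (sets (vimage_algebra (space M) X N)) (sets (vimage_algebra (space M) Y K))"
    using ind by (auto simp: independent_rvs_def)
  have sub: "sigma_sets (space M) {(\<lambda>\<omega>. u (W \<omega>)) -` A \<inter> space M |A. A \<in> sets borel} \<subseteq> sets (vimage_algebra (space M) W L)"
    if W: "W \<in> measurable M L" and u: "u \<in> borel_measurable L" for W L and u :: "_ \<Rightarrow> real"
  proof -
    have "(\<lambda>\<omega>. u (W \<omega>)) \<in> borel_measurable (vimage_algebra (space M) W L)"
      using measurable_space[OF W] by (intro measurable_compose[OF measurable_vimage_algebra1 u]) auto
    from measurable_sets[OF this] have
      "{(\<lambda>\<omega>. u (W \<omega>)) -` A \<inter> space M |A. A \<in> sets borel} \<subseteq> sets (vimage_algebra (space M) W L)"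
      by auto
    from sets.sigma_sets_subset[OF this] show ?thesis by simp
  qed
  have "indep_var borel (\<lambda>\<omega>. f (X \<omega>)) borel (\<lambda>\<omega>. g (Y \<omega>))"
    unfolding indep_var_eq
  proof (intro conjI)
    show "random_variable borel (\<lambda>\<omega>. f (X \<omega>))" "random_variable borel (\<lambda>\<omega>. g (Y \<omega>))"
      using X Y f g by auto
    show "indep_set (sigma_sets (space M) {(\<lambda>\<omega>. f (X \<omega>)) -` A \<inter> space M |A. A \<in> sets borel})
       (sigma_sets (space M) {(\<lambda>\<omega>. g (Y \<omega>)) -` A \<inter> space M |A. A \<in> sets borel})"
      using ind sub[OF X f] sub[OF Y g] unfolding indep_set_def
      by (elim indep_sets_mono_sets) (auto split: bool.split)
  qed
  then show ?thesis using int by (rule indep_var_lebesgue_integral)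
qed

text \<open>The defining property of conditional expectation, tested against a function of \<open>X\<close>.\<close>

lemma vertex_kernel_integral:
  fixes u :: "'b \<Rightarrow> real"
  assumes "prob_space M" and X: "X \<in> measurable M N" and ker: "vertex_kernel M X N Z \<Theta> p"
    and u: "u \<in> borel_measurable N" and bound: "AE \<omega> in M. \<bar>u (X \<omega>)\<bar> \<le> 1"
    and meas: "(\<lambda>\<omega>. vertex_prob p j (Z \<omega>)) \<in> borel_measurable M"
  shows "(\<integral>\<omega>. u (X \<omega>) * indicator {\<omega>\<in>space M. \<Theta> \<omega> = vertex j} \<omega> \<partial>M) =
     (\<integral>\<omega>. u (X \<omega>) * vertex_prob p j (Z \<omega>) \<partial>M)"
proof -
  interpret prob_space M by fact
  let ?F = "vimage_algebra (space M) X N"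
  have \<Theta>[measurable]: "\<Theta> \<in> borel_measurable M"
    and ce: "AE \<omega> in M. real_cond_exp M ?F (indicator {\<omega>\<in>space M. \<Theta> \<omega> = vertex j}) \<omega> = vertex_prob p j (Z \<omega>)"
    using ker by (auto simp: vertex_kernel_def)
  have "subalgebra M ?F"
    using sets_image_in_sets[OF refl X] by (auto simp: subalgebra_def)
  then interpret finite_measure_subalgebra M ?F by unfold_locales
  have uF: "(\<lambda>\<omega>. u (X \<omega>)) \<in> borel_measurable ?F"
    using measurable_space[OF X] by (intro measurable_compose[OF measurable_vimage_algebra1 u]) auto
  have uM[measurable]: "(\<lambda>\<omega>. u (X \<omega>)) \<in> borel_measurable M" using X u by auto
  have "integrable M (\<lambda>\<omega>. u (X \<omega>) * indicator {\<omega>\<in>space M. \<Theta> \<omega> = vertex j} \<omega>)"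
  proof (rule integrable_const_bound[where B = 1])
    show "AE \<omega> in M. norm (u (X \<omega>) * indicator {\<omega>\<in>space M. \<Theta> \<omega> = vertex j} \<omega>) \<le> 1"
      using bound by eventually_elim (auto simp: indicator_def)
  qed measurable
  then have "(\<integral>\<omega>. u (X \<omega>) * indicator {\<omega>\<in>space M. \<Theta> \<omega> = vertex j} \<omega> \<partial>M) =
     (\<integral>\<omega>. u (X \<omega>) * real_cond_exp M ?F (indicator {\<omega>\<in>space M. \<Theta> \<omega> = vertex j}) \<omega> \<partial>M)"
    by (intro real_cond_exp_intg(2)[symmetric] uF) auto
  also have "\<dots> = (\<integral>\<omega>. u (X \<omega>) * vertex_prob p j (Z \<omega>) \<partial>M)"
    using ce meas by (intro integral_cong_AE borel_measurable_times uM) auto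
  finally show ?thesis .
qed

lemma borel_measurable_vertex_prob_linear_p [measurable]:
  "vertex_prob (linear_p \<beta>) j \<in> borel_measurable borel"
  unfolding vertex_prob_linear_p[abs_def] by measurable

text \<open>First split off \<open>\<xi>\<close> by independence from \<open>(Z, \<Theta>)\<close>, then condition on \<open>Z\<close>.\<close>

lemma step_factorizes_pair:
  fixes Z :: "'a \<Rightarrow> real ^ 'd::finite"
  assumes M: "prob_space M" and Z[measurable]: "Z \<in> borel_measurable M"
    and ker: "vertex_kernel M Z borel Z \<Theta> (linear_p \<beta>)"
    and ind: "independent_rvs M borel \<xi> (borel \<Otimes>\<^sub>M borel) (\<lambda>\<omega>. (Z \<omega>, \<Theta> \<omega>))"
  shows "step_factorizes M Z \<xi> \<Theta> (linear_p \<beta>)"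
  unfolding step_factorizes_def
proof (intro allI ballI impI)
  fix j and g :: "real ^ 'd \<Rightarrow> real" and h :: "real \<Rightarrow> real"
  assume g[measurable]: "g \<in> borel_measurable borel" and h[measurable]: "h \<in> borel_measurable borel"
    and gb: "AE \<omega> in M. \<bar>g (Z \<omega>)\<bar> \<le> 1" and hb: "AE \<omega> in M. \<bar>h (\<xi> \<omega>)\<bar> \<le> 1"
  interpret prob_space M by fact
  have [measurable]: "\<Theta> \<in> borel_measurable M" using ker by (simp add: vertex_kernel_def)
  have \<xi>[measurable]: "\<xi> \<in> borel_measurable M" using ind by (simp add: independent_rvs_def)
  let ?I = "indicator {\<omega>\<in>space M. \<Theta> \<omega> = vertex j} :: 'a \<Rightarrow> real"
  define k :: "(real ^ 'd) \<times> (real ^ 'd) \<Rightarrow> real" where "k = (\<lambda>(z, t). indicator {vertex j} t * g z)"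
  have k: "k \<in> borel_measurable (borel \<Otimes>\<^sub>M borel)" unfolding k_def by measurable
  have kI: "k (Z \<omega>, \<Theta> \<omega>) = ?I \<omega> * g (Z \<omega>)" if "\<omega> \<in> space M" for \<omega>
    using that by (auto simp: k_def indicator_def)
  have "(\<integral>\<omega>. ?I \<omega> * (g (Z \<omega>) * h (\<xi> \<omega>)) \<partial>M) = (\<integral>\<omega>. h (\<xi> \<omega>) * k (Z \<omega>, \<Theta> \<omega>) \<partial>M)"
    by (intro Bochner_Integration.integral_cong) (auto simp: kI)
  also have "\<dots> = (\<integral>\<omega>. h (\<xi> \<omega>) \<partial>M) * (\<integral>\<omega>. k (Z \<omega>, \<Theta> \<omega>) \<partial>M)"
  proof (rule independent_rvs_integral_mult[OF M ind h k])
    show "integrable M (\<lambda>\<omega>. h (\<xi> \<omega>))" using hb by (intro integrable_const_bound[where B = 1]) auto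
    show "integrable M (\<lambda>\<omega>. k (Z \<omega>, \<Theta> \<omega>))"
      using gb by (intro integrable_const_bound[where B = 1])
        (auto simp: k_def indicator_def elim!: eventually_mono)
  qed
  also have "(\<integral>\<omega>. k (Z \<omega>, \<Theta> \<omega>) \<partial>M) = (\<integral>\<omega>. g (Z \<omega>) * ?I \<omega> \<partial>M)"
    by (intro Bochner_Integration.integral_cong) (auto simp: kI)
  also have "\<dots> = (\<integral>\<omega>. g (Z \<omega>) * vertex_prob (linear_p \<beta>) j (Z \<omega>) \<partial>M)"
    by (rule vertex_kernel_integral[OF M Z ker g gb]) measurable
  finally show "(\<integral>\<omega>. ?I \<omega> * (g (Z \<omega>) * h (\<xi> \<omega>)) \<partial>M) =
      (\<integral>\<omega>. vertex_prob (linear_p \<beta>) j (Z \<omega>) * g (Z \<omega>) \<partial>M) * (\<integral>\<omega>. h (\<xi> \<omega>) \<partial>M)"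
    by (simp add: mult.commute)
qed

lemma vertex_prob_bounds:
  assumes "\<And>k. \<beta> k > 0" "\<And>k. (\<Sum>j\<in>UNIV. \<beta> j) - \<beta> k < 1" "z \<in> orth_simplex"
  shows "0 \<le> vertex_prob (linear_p \<beta>) j z" "vertex_prob (linear_p \<beta>) j z \<le> 1"
  using linear_p_in_simplex[OF assms] bary_le_1[of "linear_p \<beta> z" j]
  by (auto simp: orth_simplex_iff_bary bary_linear_p)

text \<open>
  Here the order is reversed: first condition on the history and \<open>\<xi>\<close>, which turns the indicator of
  the vertex into a function of \<open>Z\<^sub>n\<close>, then split off \<open>\<xi>\<close> by independence from the history.
\<close>

lemma step_factorizes_chain:
  fixes Z :: "nat \<Rightarrow> 'a \<Rightarrow> real ^ 'd::finite"
  assumes M: "prob_space M"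
    and \<beta>: "\<And>k. \<beta> k > 0" "\<And>k. (\<Sum>j\<in>UNIV. \<beta> j) - \<beta> k < 1"
    and simplex: "AE \<omega> in M. Z n \<omega> \<in> orth_simplex"
    and ind: "independent_rvs M borel \<xi> (PiM {..n} (\<lambda>_. borel)) (\<lambda>\<omega>. \<lambda>k\<in>{..n}. Z k \<omega>)"
    and ker: "vertex_kernel M (\<lambda>\<omega>. (\<lambda>k\<in>{..n}. Z k \<omega>, \<xi> \<omega>))
        (PiM {..n} (\<lambda>_. borel) \<Otimes>\<^sub>M borel) (Z n) \<Theta> (linear_p \<beta>)"
  shows "step_factorizes M (Z n) \<xi> \<Theta> (linear_p \<beta>)"
  unfolding step_factorizes_def
proof (intro allI ballI impI)
  fix j and g :: "real ^ 'd \<Rightarrow> real" and h :: "real \<Rightarrow> real"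
  assume g[measurable]: "g \<in> borel_measurable borel" and h[measurable]: "h \<in> borel_measurable borel"
    and gb: "AE \<omega> in M. \<bar>g (Z n \<omega>)\<bar> \<le> 1" and hb: "AE \<omega> in M. \<bar>h (\<xi> \<omega>)\<bar> \<le> 1"
  interpret prob_space M by fact
  let ?H = "\<lambda>\<omega>. \<lambda>k\<in>{..n}. Z k \<omega>" and ?P = "PiM {..n} (\<lambda>_. borel :: (real ^ 'd) measure)"
  let ?I = "indicator {\<omega>\<in>space M. \<Theta> \<omega> = vertex j} :: 'a \<Rightarrow> real"
  have \<xi>[measurable]: "\<xi> \<in> borel_measurable M" and H[measurable]: "?H \<in> measurable M ?P"
    using ind by (auto simp: independent_rvs_def)
  have proj[measurable]: "(\<lambda>f. f n) \<in> measurable ?P borel" by measurable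
  have Z[measurable]: "Z n \<in> borel_measurable M"
    using measurable_compose[OF H proj] by simp
  have "(\<integral>\<omega>. ?I \<omega> * (g (Z n \<omega>) * h (\<xi> \<omega>)) \<partial>M) =
      (\<integral>\<omega>. (\<lambda>(f, x). g (f n) * h x) (?H \<omega>, \<xi> \<omega>) * ?I \<omega> \<partial>M)"
    by (simp add: mult_ac)
  also have "\<dots> = (\<integral>\<omega>. (\<lambda>(f, x). g (f n) * h x) (?H \<omega>, \<xi> \<omega>) * vertex_prob (linear_p \<beta>) j (Z n \<omega>) \<partial>M)"
  proof (rule vertex_kernel_integral[OF M _ ker])
    show "AE \<omega> in M. \<bar>(\<lambda>(f, x). g (f n) * h x) (?H \<omega>, \<xi> \<omega>)\<bar> \<le> 1"
      using gb hb by eventually_elim (auto simp: abs_mult mult_le_one)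
  qed measurable
  also have "\<dots> = (\<integral>\<omega>. h (\<xi> \<omega>) * (\<lambda>f. vertex_prob (linear_p \<beta>) j (f n) * g (f n)) (?H \<omega>) \<partial>M)"
    by (simp add: mult_ac)
  also have "\<dots> = (\<integral>\<omega>. h (\<xi> \<omega>) \<partial>M) * (\<integral>\<omega>. (\<lambda>f. vertex_prob (linear_p \<beta>) j (f n) * g (f n)) (?H \<omega>) \<partial>M)"
  proof (rule independent_rvs_integral_mult[OF M ind h])
    show "integrable M (\<lambda>\<omega>. h (\<xi> \<omega>))" using hb by (intro integrable_const_bound[where B = 1]) auto
    show "integrable M (\<lambda>\<omega>. (\<lambda>f. vertex_prob (linear_p \<beta>) j (f n) * g (f n)) (?H \<omega>))"
    proof (rule integrable_const_bound[where B = 1])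
      show "AE \<omega> in M. norm ((\<lambda>f. vertex_prob (linear_p \<beta>) j (f n) * g (f n)) (?H \<omega>)) \<le> 1"
        using simplex gb
      proof eventually_elim
        case (elim \<omega>)
        have "\<bar>vertex_prob (linear_p \<beta>) j (Z n \<omega>)\<bar> \<le> 1"
          using vertex_prob_bounds[OF \<beta> elim(1), of j] by simp
        then show ?case using elim(2) by (simp add: abs_mult mult_le_one)
      qed
    qed measurable
  qed measurable
  finally show "(\<integral>\<omega>. ?I \<omega> * (g (Z n \<omega>) * h (\<xi> \<omega>)) \<partial>M) =
      (\<integral>\<omega>. vertex_prob (linear_p \<beta>) j (Z n \<omega>) * g (Z n \<omega>) \<partial>M) * (\<integral>\<omega>. h (\<xi> \<omega>) \<partial>M)"
    by (simp add: mult.commute)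
qed

text \<open>
  On the event that \<open>\<Theta>\<close> is the \<open>j\<close>-th vertex the new monomial is a binomial sum of products of a
  function of \<open>Z\<close> and a function of \<open>\<xi>\<close> (\<open>bary_monomial_towards_vertex\<close>), so the expectations factor.
\<close>

lemma moments_one_step:
  fixes Z Z' :: "'a \<Rightarrow> real ^ 'd::finite"
  assumes M: "prob_space M" and \<gamma>: "\<gamma> > 0"
    and Z[measurable]: "Z \<in> borel_measurable M" and simplex: "AE \<omega> in M. Z \<omega> \<in> orth_simplex"
    and \<xi>[measurable]: "\<xi> \<in> borel_measurable M" and law: "distr M borel \<xi> = beta_distribution 1 \<gamma>"
    and \<Theta>[measurable]: "\<Theta> \<in> borel_measurable M" and vert: "\<And>\<omega>. \<omega> \<in> space M \<Longrightarrow> \<Theta> \<omega> \<in> range vertex"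
    and fac: "step_factorizes M Z \<xi> \<Theta> (linear_p \<beta>)"
    and Z': "\<And>\<omega>. \<omega> \<in> space M \<Longrightarrow> Z' \<omega> = (1 - \<xi> \<omega>) *\<^sub>R Z \<omega> + \<xi> \<omega> *\<^sub>R \<Theta> \<omega>"
  shows "(\<integral>\<omega>. bary_monomial m (Z' \<omega>) \<partial>M) = moment_step \<gamma> \<beta> (\<lambda>m. \<integral>\<omega>. bary_monomial m (Z \<omega>) \<partial>M) m"
proof -
  interpret prob_space M by fact
  define N where "N = sum m UNIV"
  define h where "h i x = (1 - x) ^ (N - i) * x ^ i" for i and x :: real
  define L where "L m = (\<integral>\<omega>. bary_monomial m (Z \<omega>) \<partial>M)" for m
  let ?p = "\<lambda>j \<omega>. vertex_prob (linear_p \<beta>) j (Z \<omega>)"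
  let ?I = "\<lambda>j. indicator {\<omega>\<in>space M. \<Theta> \<omega> = vertex j} :: 'a \<Rightarrow> real"
  have \<xi>01: "AE \<omega> in M. 0 < \<xi> \<omega> \<and> \<xi> \<omega> < 1"
    using AE_beta_distribution[of 1 \<gamma>] unfolding law[symmetric] by (subst (asm) AE_distr_iff) auto
  have hb: "AE \<omega> in M. \<bar>h i (\<xi> \<omega>)\<bar> \<le> 1" for i
    using \<xi>01 by eventually_elim (auto simp: h_def abs_mult power_abs intro!: mult_le_one power_le_one)
  have gb: "AE \<omega> in M. \<bar>bary_monomial m (Z \<omega>)\<bar> \<le> 1" for m
    using simplex by eventually_elim (auto simp: bary_monomial_bounds)
  have [measurable]: "h i \<in> borel_measurable borel" for i unfolding h_def by measurable
  have int: "integrable M (\<lambda>\<omega>. ?I j \<omega> * (bary_monomial m (Z \<omega>) * h i (\<xi> \<omega>)))" for j m i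
  proof (rule integrable_const_bound[where B = 1])
    show "AE \<omega> in M. norm (?I j \<omega> * (bary_monomial m (Z \<omega>) * h i (\<xi> \<omega>))) \<le> 1"
      using gb[of m] hb[of i] by eventually_elim (auto simp: indicator_def abs_mult intro!: mult_le_one)
  qed measurable
  have int_bary_monomial: "integrable M (\<lambda>\<omega>. bary_monomial m (Z \<omega>))" for m
    by (rule integrable_bary_monomial[OF M Z simplex])
  have eh: "(\<integral>\<omega>. h i (\<xi> \<omega>) \<partial>M) = beta_moment \<gamma> N i" if "i \<le> N" for i
  proof -
    have "(\<integral>\<omega>. h i (\<xi> \<omega>) \<partial>M) = (\<integral>x. h i x \<partial>distr M borel \<xi>)" by (rule integral_distr[symmetric]) auto
    then show ?thesis using integral_beta_distribution_1[OF \<gamma> that] by (simp add: law h_def)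
  qed
  have mN: "m j \<le> N" for j unfolding N_def using member_le_sum[of j UNIV m] by simp
  have expand: "bary_monomial m (Z' \<omega>) = (\<Sum>j\<in>UNIV. \<Sum>i\<le>m j. real (m j choose i) * (?I j \<omega> * (bary_monomial (lower m j i) (Z \<omega>) * h i (\<xi> \<omega>))))"
    if \<omega>: "\<omega> \<in> space M" for \<omega>
  proof -
    obtain j0 where j0: "\<Theta> \<omega> = vertex j0" using vert[OF \<omega>] by auto
    have I: "?I j \<omega> = (if j = j0 then 1 else 0)" for j using \<omega> by (auto simp: j0 vertex_eq_iff)
    have "(\<Sum>j\<in>UNIV. \<Sum>i\<le>m j. real (m j choose i) * (?I j \<omega> * (bary_monomial (lower m j i) (Z \<omega>) * h i (\<xi> \<omega>)))) =
       (\<Sum>j\<in>UNIV. if j = j0 then (\<Sum>i\<le>m j. real (m j choose i) * (bary_monomial (lower m j i) (Z \<omega>) * h i (\<xi> \<omega>))) else 0)"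
      by (intro sum.cong refl) (simp add: I)
    also have "\<dots> = bary_monomial m (Z' \<omega>)"
      by (simp add: Z'[OF \<omega>] j0 bary_monomial_towards_vertex h_def N_def)
    finally show ?thesis by simp
  qed
  have "(\<integral>\<omega>. bary_monomial m (Z' \<omega>) \<partial>M) = (\<integral>\<omega>. (\<Sum>j\<in>UNIV. \<Sum>i\<le>m j. real (m j choose i) * (?I j \<omega> * (bary_monomial (lower m j i) (Z \<omega>) * h i (\<xi> \<omega>)))) \<partial>M)"
    by (rule Bochner_Integration.integral_cong[OF refl expand])
  also have "\<dots> = (\<Sum>j\<in>UNIV. \<Sum>i\<le>m j. real (m j choose i) * (\<integral>\<omega>. ?I j \<omega> * (bary_monomial (lower m j i) (Z \<omega>) * h i (\<xi> \<omega>)) \<partial>M))"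
    by (simp add: Bochner_Integration.integral_sum int)
  also have "\<dots> = (\<Sum>j\<in>UNIV. \<Sum>i\<le>m j. real (m j choose i) * ((\<integral>\<omega>. ?p j \<omega> * bary_monomial (lower m j i) (Z \<omega>) \<partial>M) * beta_moment \<gamma> N i))"
  proof (intro sum.cong refl)
    fix j i assume "i \<in> {..m j}"
    then have "i \<le> N" using mN[of j] by simp
    then show "real (m j choose i) * (\<integral>\<omega>. ?I j \<omega> * (bary_monomial (lower m j i) (Z \<omega>) * h i (\<xi> \<omega>)) \<partial>M) =
       real (m j choose i) * ((\<integral>\<omega>. ?p j \<omega> * bary_monomial (lower m j i) (Z \<omega>) \<partial>M) * beta_moment \<gamma> N i)"
      using fac[unfolded step_factorizes_def, rule_format, of "bary_monomial (lower m j i)" "h i" j] gb hb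
      by (simp add: eh)
  qed
  also have "\<dots> = (\<Sum>j\<in>UNIV. (\<integral>\<omega>. ?p j \<omega> * bary_monomial m (Z \<omega>) \<partial>M) * beta_moment \<gamma> N 0 +
     (\<Sum>i\<in>{1..m j}. real (m j choose i) * ((\<integral>\<omega>. ?p j \<omega> * bary_monomial (lower m j i) (Z \<omega>) \<partial>M) * beta_moment \<gamma> N i)))"
    by (simp add: sum.atMost_shift sum.atLeast1_atMost_eq lower_def)
  also have "\<dots> = (\<Sum>j\<in>UNIV. \<integral>\<omega>. ?p j \<omega> * bary_monomial m (Z \<omega>) \<partial>M) * beta_moment \<gamma> N 0 +
     (\<Sum>j\<in>UNIV. \<Sum>i\<in>{1..m j}. real (m j choose i) * ((\<integral>\<omega>. ?p j \<omega> * bary_monomial (lower m j i) (Z \<omega>) \<partial>M) * beta_moment \<gamma> N i))"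
    by (simp add: sum.distrib sum_distrib_right)
  also have "(\<Sum>j\<in>UNIV. \<integral>\<omega>. ?p j \<omega> * bary_monomial m (Z \<omega>) \<partial>M) = L m"
  proof -
    \<comment> \<open>Only integrability of the summands needs this expansion, in which the degree goes up by one;
      after the sum over \<open>j\<close> the extra degree disappears.\<close>
    have pe: "?p j \<omega> * bary_monomial m (Z \<omega>) = \<beta> j * bary_monomial m (Z \<omega>) + (1 - sum \<beta> UNIV) * bary_monomial (m(j := m j + 1)) (Z \<omega>)" for j \<omega>
      using bary_mult_bary_monomial_lower[of 1 "m(j := m j + 1)" j "Z \<omega>"]
      by (simp add: vertex_prob_linear_p lower_def algebra_simps)
    have "integrable M (\<lambda>\<omega>. ?p j \<omega> * bary_monomial m (Z \<omega>))" for j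
      unfolding pe by (intro Bochner_Integration.integrable_add integrable_mult_right int_bary_monomial)
    then have "(\<Sum>j\<in>UNIV. \<integral>\<omega>. ?p j \<omega> * bary_monomial m (Z \<omega>) \<partial>M) = (\<integral>\<omega>. (\<Sum>j\<in>UNIV. ?p j \<omega> * bary_monomial m (Z \<omega>)) \<partial>M)"
      by simp
    also have "\<dots> = L m"
      unfolding L_def
    proof (intro Bochner_Integration.integral_cong refl)
      show "(\<Sum>j\<in>UNIV. ?p j \<omega> * bary_monomial m (Z \<omega>)) = bary_monomial m (Z \<omega>)" for \<omega>
        using sum_bary[of "linear_p \<beta> (Z \<omega>)"] by (simp add: bary_linear_p sum_distrib_right[symmetric])
    qed
    finally show ?thesis .
  qed
  also have "(\<Sum>j\<in>UNIV. \<Sum>i\<in>{1..m j}. real (m j choose i) * ((\<integral>\<omega>. ?p j \<omega> * bary_monomial (lower m j i) (Z \<omega>) \<partial>M) * beta_moment \<gamma> N i)) =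
     (\<Sum>j\<in>UNIV. \<Sum>i\<in>{1..m j}. real (m j choose i) * beta_moment \<gamma> N i *
        (\<beta> j * L (lower m j i) + (1 - (\<Sum>k\<in>UNIV. \<beta> k)) * L (lower m j (i - 1))))"
  proof (intro sum.cong refl)
    fix j i assume i: "i \<in> {1..m j}"
    have "?p j \<omega> * bary_monomial (lower m j i) (Z \<omega>) = \<beta> j * bary_monomial (lower m j i) (Z \<omega>) + (1 - sum \<beta> UNIV) * bary_monomial (lower m j (i - 1)) (Z \<omega>)" for \<omega>
      using bary_mult_bary_monomial_lower[of i m j "Z \<omega>"] i
      by (simp add: vertex_prob_linear_p algebra_simps)
    then have "(\<integral>\<omega>. ?p j \<omega> * bary_monomial (lower m j i) (Z \<omega>) \<partial>M) = \<beta> j * L (lower m j i) + (1 - sum \<beta> UNIV) * L (lower m j (i - 1))"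
      by (simp add: L_def int_bary_monomial)
    then show "real (m j choose i) * ((\<integral>\<omega>. ?p j \<omega> * bary_monomial (lower m j i) (Z \<omega>) \<partial>M) * beta_moment \<gamma> N i) =
       real (m j choose i) * beta_moment \<gamma> N i * (\<beta> j * L (lower m j i) + (1 - (\<Sum>k\<in>UNIV. \<beta> k)) * L (lower m j (i - 1)))"
      by (simp add: mult_ac)
  qed
  finally show ?thesis
    by (simp add: moment_step_def N_def L_def mult.commute)
qed

lemma AE_step_in_simplex:
  assumes "prob_space M" and simplex: "AE \<omega> in M. Z \<omega> \<in> orth_simplex"
    and \<xi>[measurable]: "\<xi> \<in> borel_measurable M" and law: "distr M borel \<xi> = beta_distribution 1 \<gamma>"
    and vert: "\<And>\<omega>. \<omega> \<in> space M \<Longrightarrow> \<Theta> \<omega> \<in> range vertex"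
    and Z': "\<And>\<omega>. \<omega> \<in> space M \<Longrightarrow> Z' \<omega> = (1 - \<xi> \<omega>) *\<^sub>R Z \<omega> + \<xi> \<omega> *\<^sub>R \<Theta> \<omega>"
  shows "AE \<omega> in M. Z' \<omega> \<in> orth_simplex"
proof -
  have "AE \<omega> in M. 0 < \<xi> \<omega> \<and> \<xi> \<omega> < 1"
    using AE_beta_distribution[of 1 \<gamma>] unfolding law[symmetric] by (subst (asm) AE_distr_iff) auto
  with simplex AE_space show ?thesis
  proof eventually_elim
    case (elim \<omega>)
    then show ?case using vert[of \<omega>] by (auto simp: Z' intro!: convex_comb_in_simplex vertex_in_simplex)
  qed
qed

section \<open>Stationarity and convergence\<close>

lemma moment_step_diff:
  "moment_step \<gamma> \<beta> (\<lambda>m. L m - L' m) m = moment_step \<gamma> \<beta> L m - moment_step \<gamma> \<beta> L' m"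
proof -
  have "c * (b * (x - y) + a * (x' - y')) = c * (b * x + a * x') - c * (b * y + a * y')" for a b c x y x' y' :: real
    by (simp add: algebra_simps)
  then show ?thesis unfolding moment_step_def by (simp add: sum_subtractf right_diff_distrib)
qed

lemma integral_bary_monomial_distr:
  assumes "Z \<in> borel_measurable M"
  shows "integral\<^sup>L (distr M borel Z) (bary_monomial m) = (\<integral>\<omega>. bary_monomial m (Z \<omega>) \<partial>M)"
  by (rule integral_distr[OF assms]) simp

text \<open>
  Before the step the moments are the Dirichlet moments; these are a fixed point of the recursion, so
  they are also the moments after the step.
\<close>

lemma dirichlet_stationary:
  fixes \<beta> :: "'d::finite option \<Rightarrow> real"
  assumes \<gamma>: "\<gamma> > 0" and \<beta>: "\<And>k. \<beta> k > 0"
    and M: "prob_space M" and Z[measurable]: "Z \<in> borel_measurable M"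
    and law: "distr M borel Z = dirichlet_distribution (\<lambda>i. \<beta> i * \<gamma>)"
    and \<xi>[measurable]: "\<xi> \<in> borel_measurable M" and beta: "distr M borel \<xi> = beta_distribution 1 \<gamma>"
    and ker: "vertex_kernel M Z borel Z \<Theta> (linear_p \<beta>)"
    and ind: "independent_rvs M borel \<xi> (borel \<Otimes>\<^sub>M borel) (\<lambda>\<omega>. (Z \<omega>, \<Theta> \<omega>))"
  shows "distr M borel Z = distr M borel (\<lambda>\<omega>. (1 - \<xi> \<omega>) *\<^sub>R Z \<omega> + \<xi> \<omega> *\<^sub>R \<Theta> \<omega>)"
proof -
  interpret prob_space M by fact
  have \<alpha>: "\<beta> i * \<gamma> > 0" for i using \<beta> \<gamma> by simp
  have \<Theta>[measurable]: "\<Theta> \<in> borel_measurable M" and vert: "\<And>\<omega>. \<omega> \<in> space M \<Longrightarrow> \<Theta> \<omega> \<in> range vertex"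
    using ker by (auto simp: vertex_kernel_def)
  define Z' where "Z' \<omega> = (1 - \<xi> \<omega>) *\<^sub>R Z \<omega> + \<xi> \<omega> *\<^sub>R \<Theta> \<omega>" for \<omega>
  have Z'[measurable]: "Z' \<in> borel_measurable M" unfolding Z'_def by measurable
  have simplex: "AE \<omega> in M. Z \<omega> \<in> orth_simplex"
    using AE_dirichlet_simplex[of "\<lambda>i. \<beta> i * \<gamma>"] unfolding law[symmetric]
    by (subst (asm) AE_distr_iff) auto
  have simplex': "AE \<omega> in M. Z' \<omega> \<in> orth_simplex"
    by (rule AE_step_in_simplex[OF M simplex \<xi> beta vert Z'_def])
  have L: "(\<integral>\<omega>. bary_monomial m (Z \<omega>) \<partial>M) = dirichlet_moment (\<lambda>i. \<beta> i * \<gamma>) m" for m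
    unfolding integral_bary_monomial_distr[OF Z, symmetric] law
    by (rule integral_bary_monomial_dirichlet) (rule \<alpha>)
  have "(\<integral>\<omega>. bary_monomial m (Z' \<omega>) \<partial>M) = moment_step \<gamma> \<beta> (\<lambda>m. \<integral>\<omega>. bary_monomial m (Z \<omega>) \<partial>M) m" for m
    using vert step_factorizes_pair[OF M Z ker ind] Z'_def
    by (rule moments_one_step[OF M \<gamma> Z simplex \<xi> beta \<Theta>])
  then have "(\<integral>\<omega>. bary_monomial m (Z' \<omega>) \<partial>M) = (\<integral>\<omega>. bary_monomial m (Z \<omega>) \<partial>M)" for m
    by (simp only: L dirichlet_moment_fixed[OF \<gamma> \<beta>])
  then have "distr M borel Z = distr M borel Z'"
    using simplex simplex'
    by (intro prob_measure_eqI_moments prob_space_distr) (auto simp: AE_distr_iff integral_bary_monomial_distr)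
  then show ?thesis unfolding Z'_def .
qed

text \<open>
  The recursion is linear and fixes the Dirichlet moments, so the differences between the moments of
  \<open>Z\<^sub>n\<close> and the Dirichlet moments follow it as well; they vanish in degree \<open>0\<close> and hence tend to \<open>0\<close>.
\<close>

lemma associated_chain_converges:
  fixes \<beta> :: "'d::finite option \<Rightarrow> real"
  assumes \<gamma>: "\<gamma> > 0" and \<beta>: "\<And>k. \<beta> k > 0" "\<And>k. (\<Sum>j\<in>UNIV. \<beta> j) - \<beta> k < 1"
    and chain: "associated_chain M (beta_distribution 1 \<gamma>) (linear_p \<beta>) Z \<xi> \<Theta>"
  shows "converges_weakly (\<lambda>n. distr M borel (Z n)) (dirichlet_distribution (\<lambda>i. \<beta> i * \<gamma>))"
proof -
  have M: "prob_space M" and Z0: "\<forall>\<omega>\<in>space M. Z 0 \<omega> \<in> orth_simplex"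
    and rec: "\<And>n \<omega>. \<omega> \<in> space M \<Longrightarrow> Z (Suc n) \<omega> = (1 - \<xi> n \<omega>) *\<^sub>R Z n \<omega> + \<xi> n \<omega> *\<^sub>R \<Theta> n \<omega>"
    and beta: "\<And>n. distr M borel (\<xi> n) = beta_distribution 1 \<gamma>"
    and ind: "\<And>n. independent_rvs M borel (\<xi> n) (PiM {..n} (\<lambda>_. borel)) (\<lambda>\<omega>. \<lambda>k\<in>{..n}. Z k \<omega>)"
    and ker: "\<And>n. vertex_kernel M (\<lambda>\<omega>. (\<lambda>k\<in>{..n}. Z k \<omega>, \<xi> n \<omega>))
        (PiM {..n} (\<lambda>_. borel) \<Otimes>\<^sub>M borel) (Z n) (\<Theta> n) (linear_p \<beta>)"
    using chain by (auto simp: associated_chain_def)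
  interpret prob_space M by fact
  have \<alpha>: "\<beta> i * \<gamma> > 0" for i using \<beta> \<gamma> by simp
  have \<xi>[measurable]: "\<xi> n \<in> borel_measurable M" for n
    using ind[of n] by (simp add: independent_rvs_def)
  have Z[measurable]: "Z n \<in> borel_measurable M" for n
  proof -
    have "(\<lambda>\<omega>. \<lambda>k\<in>{..n}. Z k \<omega>) \<in> measurable M (PiM {..n} (\<lambda>_. borel))"
      using ind[of n] by (simp add: independent_rvs_def)
    from measurable_compose[OF this measurable_component_singleton[of n]] show ?thesis by simp
  qed
  have \<Theta>[measurable]: "\<Theta> n \<in> borel_measurable M" and vert: "\<And>\<omega>. \<omega> \<in> space M \<Longrightarrow> \<Theta> n \<omega> \<in> range vertex" for n
    using ker[of n] by (auto simp: vertex_kernel_def)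
  have simplex: "AE \<omega> in M. Z n \<omega> \<in> orth_simplex" for n
  proof (induction n)
    case 0
    show ?case using Z0 by auto
  next
    case (Suc n)
    show ?case by (rule AE_step_in_simplex[OF M Suc \<xi> beta vert rec])
  qed
  define L where "L n m = (\<integral>\<omega>. bary_monomial m (Z n \<omega>) \<partial>M)" for n m
  define D where "D n m = L n m - dirichlet_moment (\<lambda>i. \<beta> i * \<gamma>) m" for n m
  have "L (Suc n) m = moment_step \<gamma> \<beta> (L n) m" for n m
    unfolding L_def using vert step_factorizes_chain[OF M \<beta> simplex ind ker] rec
    by (rule moments_one_step[OF M \<gamma> Z simplex \<xi> beta \<Theta>])
  then have step: "D (Suc n) m = moment_step \<gamma> \<beta> (D n) m" for n m
    unfolding D_def moment_step_diff dirichlet_moment_fixed[OF \<gamma> \<beta>(1)] by simp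
  have "(\<lambda>n. D n m) \<longlonglongrightarrow> 0" for m
  proof (rule moment_iteration_tendsto_0[where D = D and \<beta> = \<beta>, OF \<gamma> _ sum_beta_less_2[OF \<beta>] step])
    show "0 < sum \<beta> UNIV" by (intro sum_pos) (auto simp: \<beta>)
    show "D n m = 0" if "sum m UNIV = 0" for n m
    proof -
      have "m = (\<lambda>_. 0)" using that by auto
      then show ?thesis by (simp add: D_def L_def bary_monomial_def dirichlet_moment_def prob_space)
    qed
  qed
  then have lim: "(\<lambda>n. L n m) \<longlonglongrightarrow> dirichlet_moment (\<lambda>i. \<beta> i * \<gamma>) m" for m
    unfolding D_def by (rule LIM_zero_cancel)
  show ?thesis
  proof (rule converges_weakly_of_moments)
    show "(\<lambda>n. integral\<^sup>L (distr M borel (Z n)) (bary_monomial m)) \<longlonglongrightarrow>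
        integral\<^sup>L (dirichlet_distribution (\<lambda>i. \<beta> i * \<gamma>)) (bary_monomial m)" for m
      using lim[of m] by (simp add: integral_bary_monomial_dirichlet[OF \<alpha>] integral_bary_monomial_distr L_def)
  qed (use simplex in \<open>auto simp: AE_distr_iff prob_space_distr prob_space_dirichlet \<alpha> AE_dirichlet_simplex\<close>)
qed

theorem theorem3p2:
  fixes \<beta> :: "'d::finite option \<Rightarrow> real" and \<gamma> :: real
  assumes "\<gamma> > 0"
    and "\<And>k. \<beta> k > 0"
    and "\<And>k. (\<Sum>j\<in>UNIV. \<beta> j) - \<beta> k < 1"
  shows "(\<forall>z\<in>orth_simplex. linear_p \<beta> z \<in> orth_simplex) \<and>
    (\<forall>(M :: 'a measure) (Z :: 'a \<Rightarrow> real ^ 'd) (\<xi> :: 'a \<Rightarrow> real) (\<Theta> :: 'a \<Rightarrow> real ^ 'd).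
       prob_space M \<longrightarrow>
       Z \<in> borel_measurable M \<longrightarrow>
       distr M borel Z = dirichlet_distribution (\<lambda>i. \<beta> i * \<gamma>) \<longrightarrow>
       \<xi> \<in> borel_measurable M \<longrightarrow>
       distr M borel \<xi> = beta_distribution 1 \<gamma> \<longrightarrow>
       vertex_kernel M Z borel Z \<Theta> (linear_p \<beta>) \<longrightarrow>
       independent_rvs M borel \<xi> (borel \<Otimes>\<^sub>M borel) (\<lambda>\<omega>. (Z \<omega>, \<Theta> \<omega>)) \<longrightarrow>
       distr M borel Z = distr M borel (\<lambda>\<omega>. (1 - \<xi> \<omega>) *\<^sub>R Z \<omega> + \<xi> \<omega> *\<^sub>R \<Theta> \<omega>)) \<and>
    (\<forall>(M :: 'b measure) (Z :: nat \<Rightarrow> 'b \<Rightarrow> real ^ 'd) \<xi> \<Theta>.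
       associated_chain M (beta_distribution 1 \<gamma>) (linear_p \<beta>) Z \<xi> \<Theta> \<longrightarrow>
       converges_weakly (\<lambda>n. distr M borel (Z n)) (dirichlet_distribution (\<lambda>i. \<beta> i * \<gamma>)))"
proof (intro conjI)
  show "\<forall>z\<in>orth_simplex. linear_p \<beta> z \<in> orth_simplex"
    using linear_p_in_simplex[OF assms(2,3)] by blast
next
  show "\<forall>(M :: 'a measure) (Z :: 'a \<Rightarrow> real ^ 'd) (\<xi> :: 'a \<Rightarrow> real) (\<Theta> :: 'a \<Rightarrow> real ^ 'd).
       prob_space M \<longrightarrow> Z \<in> borel_measurable M \<longrightarrow>
       distr M borel Z = dirichlet_distribution (\<lambda>i. \<beta> i * \<gamma>) \<longrightarrow>
       \<xi> \<in> borel_measurable M \<longrightarrow> distr M borel \<xi> = beta_distribution 1 \<gamma> \<longrightarrow>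
       vertex_kernel M Z borel Z \<Theta> (linear_p \<beta>) \<longrightarrow>
       independent_rvs M borel \<xi> (borel \<Otimes>\<^sub>M borel) (\<lambda>\<omega>. (Z \<omega>, \<Theta> \<omega>)) \<longrightarrow>
       distr M borel Z = distr M borel (\<lambda>\<omega>. (1 - \<xi> \<omega>) *\<^sub>R Z \<omega> + \<xi> \<omega> *\<^sub>R \<Theta> \<omega>)"
    by (intro allI impI) (rule dirichlet_stationary[OF assms(1,2)])
next
  show "\<forall>(M :: 'b measure) (Z :: nat \<Rightarrow> 'b \<Rightarrow> real ^ 'd) \<xi> \<Theta>.
       associated_chain M (beta_distribution 1 \<gamma>) (linear_p \<beta>) Z \<xi> \<Theta> \<longrightarrow>
       converges_weakly (\<lambda>n. distr M borel (Z n)) (dirichlet_distribution (\<lambda>i. \<beta> i * \<gamma>))"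
    by (intro allI impI) (rule associated_chain_converges[OF assms])
qed

end
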